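(* Let $K$ be a field of characteristic $0$, let $k\geq 1$ and $d\geq 1$ be integers, let $U_k$ be the algebra of $k\times k$ upper triangular matrices over $K$, and let $F_d(U_k)$ be the relatively free algebra of rank $d$ of the variety generated by $U_k$. Then the Hilbert series of $F_d(U_k)$ is \[ H(F_d(U_k),T_d)=\frac{1}{t_1+\cdots +t_d-1}\left(\left(1+(t_1+\cdots+t_d-1)\prod_{i=1}^d\frac{1}{1-t_i}\right)^k-1\right) \] \[ =\sum_{j=1}^k\binom{k}{j}\left(\prod_{i=1}^d\frac{1}{1-t_i}\right)^j(t_1+\cdots+t_d-1)^{j-1}. \]
   Context: All algebras are unital associative over a field $K$ of characteristic $0$. Let $K\langle X\rangle=K\langle x_1,x_2,\ldots\rangle$ be the free unital associative algebra of countable rank and $K\langle X_d\rangle=K\langle x_1,\ldots,x_d\rangle$ its free subalgebra of rank $d$. For a PI-algebra $R$, $T(R)\subset K\langle X\rangle$ is the T-ideal of all polynomial identities of $R$, and \[ F_d(R)=K\langle X_d\rangle/(K\langle X_d\rangle\cap T(R)) \] is the relatively free algebra of rank $d$. It is multigraded by $\mathbb{Z}_{\geq 0}^d$, where $x_i$ has degree equal to the $i$-th standard basis vector; $F_d^{(n_1,\ldots,n_d)}(R)$ denotes the homogeneous component of degree $(n_1,\ldots,n_d)$. Its Hilbert series is \[ H(F_d(R),T_d)=\sum_{n_i\geq 0}\dim_K\left(F_d^{(n_1,\ldots,n_d)}(R)\right)t_1^{n_1}\cdots t_d^{n_d},\qquad T_d=(t_1,\ldots,t_d). \] Rational functions whose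 expansions make sense are identified with the corresponding formal power series in $\mathbb{C}[[t_1,\ldots,t_d]]$. *)

theory Defs
  imports
    "HOL-Library.Poly_Mapping"
    "Jordan_Normal_Form.Matrix"
    "HOL-Algebra.QuotRing"
    "HOL-Algebra.Embedded_Algebras"
begin

section \<open>Formal power series in the commuting variables \<open>t\<^sub>0, t\<^sub>1, \<dots>\<close>\<close>

text \<open>
  A monomial \<open>\<Prod> t\<^sub>i ^ m\<^sub>i\<close> is given by its finitely supported exponent vector \<open>m\<close>, and a series
  by its coefficient function. The ring of series in \<open>d\<close> variables is the subring of those series
  all of whose monomials are supported on \<open>{..<d}\<close>.
\<close>

typedef 'a mfps = "UNIV :: ((nat \<Rightarrow>\<^sub>0 nat) \<Rightarrow> 'a) set"
  morphisms mfps_nth Abs_mfps ..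

setup_lifting type_definition_mfps

lemma mfps_nth_Abs [simp]: "mfps_nth (Abs_mfps c) = c"
  by (simp add: Abs_mfps_inverse)

lemma mfps_ext: "(\<And>m. mfps_nth f m = mfps_nth g m) \<Longrightarrow> f = g"
  by (metis ext mfps_nth_inverse)

definition splits :: "(nat \<Rightarrow>\<^sub>0 nat) \<Rightarrow> ((nat \<Rightarrow>\<^sub>0 nat) \<times> (nat \<Rightarrow>\<^sub>0 nat)) set" where
  "splits m = {(a, b). a + b = m}"

lemma splits_iff: "(a, b) \<in> splits m \<longleftrightarrow> a + b = m"
  by (simp add: splits_def)

lemma finite_splits [simp]: "finite (splits m)"
proof -
  let ?B = "\<Union>i\<in>Poly_Mapping.keys m. {..Poly_Mapping.lookup m i}"
  let ?F = "{f :: nat \<Rightarrow> nat.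
    \<forall>x. (x \<in> Poly_Mapping.keys m \<longrightarrow> f x \<in> ?B) \<and> (x \<notin> Poly_Mapping.keys m \<longrightarrow> f x = 0)}"
  have fin: "finite ?F"
    by (rule finite_set_of_finite_funs) auto
  have "Poly_Mapping.lookup a \<in> ?F" if "a + b = m" for a b
  proof -
    have le: "Poly_Mapping.lookup a x \<le> Poly_Mapping.lookup m x" for x
      using that by (auto simp: lookup_add)
    have "Poly_Mapping.lookup a x \<in> ?B" if "x \<in> Poly_Mapping.keys m" for x
      using le[of x] that by blast
    moreover have "Poly_Mapping.lookup a x = 0" if "x \<notin> Poly_Mapping.keys m" for x
      using le[of x] that by (simp add: in_keys_iff)
    ultimately show ?thesis
      by blast
  qed
  then have "Poly_Mapping.lookup ` (fst ` splits m) \<subseteq> ?F"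
    by (auto simp: splits_def)
  then have "finite (fst ` splits m)"
    using fin by (meson finite_imageD finite_subset inj_onI lookup_inject)
  moreover have "inj_on fst (splits m)"
    by (auto simp: inj_on_def splits_def)
  ultimately show ?thesis
    by (simp add: finite_image_iff)
qed

instantiation mfps :: (comm_ring_1) comm_ring_1
begin

lift_definition zero_mfps :: "'a mfps" is "\<lambda>_. 0" .
lift_definition one_mfps :: "'a mfps" is "\<lambda>m. if m = 0 then 1 else 0" .
lift_definition plus_mfps :: "'a mfps \<Rightarrow> 'a mfps \<Rightarrow> 'a mfps" is "\<lambda>f g m. f m + g m" .
lift_definition minus_mfps :: "'a mfps \<Rightarrow> 'a mfps \<Rightarrow> 'a mfps" is "\<lambda>f g m. f m - g m" .
lift_definition uminus_mfps :: "'a mfps \<Rightarrow> 'a mfps" is "\<lambda>f m. - f m" .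
lift_definition times_mfps :: "'a mfps \<Rightarrow> 'a mfps \<Rightarrow> 'a mfps"
  is "\<lambda>f g m. \<Sum>(a, b)\<in>splits m. f a * g b" .

instance
proof
  fix f g h :: "'a mfps"
  show "f * g * h = f * (g * h)"
  proof (rule mfps_ext)
    fix m
    have "mfps_nth (f * g * h) m =
        (\<Sum>((c, e), (a, b))\<in>Sigma (splits m) (\<lambda>(c, e). splits c).
           mfps_nth f a * mfps_nth g b * mfps_nth h e)"
      by (simp add: times_mfps.rep_eq sum_distrib_right sum.Sigma case_prod_unfold)
    also have "\<dots> = (\<Sum>((a, c), (b, e))\<in>Sigma (splits m) (\<lambda>(a, c). splits c).
           mfps_nth f a * (mfps_nth g b * mfps_nth h e))"
      by (rule sum.reindex_bij_witness
            [where i = "\<lambda>((a, c), (b, e)). ((a + b, e), (a, b))"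
               and j = "\<lambda>((c, e), (a, b)). ((a, b + e), (b, e))"])
         (auto simp: splits_def algebra_simps)
    also have "\<dots> = mfps_nth (f * (g * h)) m"
      by (simp add: times_mfps.rep_eq sum_distrib_left sum.Sigma case_prod_unfold)
    finally show "mfps_nth (f * g * h) m = mfps_nth (f * (g * h)) m" .
  qed
  show "f * g = g * f"
    by (rule mfps_ext, unfold times_mfps.rep_eq,
        rule sum.reindex_bij_witness[where i = prod.swap and j = prod.swap])
       (auto simp: splits_def algebra_simps)
  show "1 * f = f"
  proof (rule mfps_ext)
    fix m
    have "mfps_nth (1 * f) m = (\<Sum>x\<in>splits m. if x = (0, m) then mfps_nth f m else 0)"
      unfolding times_mfps.rep_eq one_mfps.rep_eq
      by (rule sum.cong) (auto simp: splits_def split: if_splits)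
    also have "\<dots> = mfps_nth f m"
      by (simp add: splits_iff)
    finally show "mfps_nth (1 * f) m = mfps_nth f m" .
  qed
  show "(f + g) * h = f * h + g * h"
    by (rule mfps_ext)
       (simp add: times_mfps.rep_eq plus_mfps.rep_eq case_prod_unfold ring_distribs sum.distrib)
  have "mfps_nth (0 :: 'a mfps) 0 \<noteq> mfps_nth 1 0"
    by (simp add: zero_mfps.rep_eq one_mfps.rep_eq)
  then show "(0::'a mfps) \<noteq> 1"
    by auto
  show "f + g + h = f + (g + h)" "f + g = g + f" "0 + f = f" "- f + f = 0" "f - g = f + - g"
    by (transfer; simp add: add_ac)+
qed

end

text \<open>
  The inverse of a unit; as usual, non-units are given the inverse \<open>0\<close>. Over a field the units
  are the series with non-zero constant coefficient, see \<open>mfps_right_inverse\<close> below.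
\<close>

instantiation mfps :: (comm_ring_1) inverse
begin

definition inverse_mfps :: "'a mfps \<Rightarrow> 'a mfps" where
  "inverse (f :: 'a mfps) = (if \<exists>g. f * g = 1 then THE g. f * g = 1 else 0)"

definition divide_mfps :: "'a mfps \<Rightarrow> 'a mfps \<Rightarrow> 'a mfps" where
  "(f :: 'a mfps) div g = f * inverse g"

instance ..

end

lemma mfps_inverse_unique:
  fixes f g :: "'a::comm_ring_1 mfps"
  assumes "f * g = 1"
  shows "inverse f = g"
proof -
  have "h = g" if "f * h = 1" for h
    using assms that by (metis mult.assoc mult.commute mult.right_neutral)
  with assms have "(THE g. f * g = 1) = g"
    by blast
  with assms show ?thesis
    by (auto simp: inverse_mfps_def)
qed

definition total_degree :: "(nat \<Rightarrow>\<^sub>0 nat) \<Rightarrow> nat" where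
  "total_degree m = (\<Sum>i\<in>Poly_Mapping.keys m. Poly_Mapping.lookup m i)"

lemma total_degree_add: "total_degree (a + b) = total_degree a + total_degree b"
  unfolding total_degree_def by (rule setsum_keys_plus_distrib[where f = "\<lambda>_ x. x"]) simp_all

lemma total_degree_eq_0_iff: "total_degree m = 0 \<longleftrightarrow> m = 0"
proof
  assume "total_degree m = 0"
  then show "m = 0"
    by (intro poly_mapping_eqI) (auto simp: total_degree_def in_keys_iff)
qed (simp add: total_degree_def)

function inverse_coeff :: "((nat \<Rightarrow>\<^sub>0 nat) \<Rightarrow> 'a::field) \<Rightarrow> (nat \<Rightarrow>\<^sub>0 nat) \<Rightarrow> 'a" where
  "inverse_coeff c m =
     ((if m = 0 then 1 else 0) - (\<Sum>(a, b)\<in>splits m - {(0, m)}. c a * inverse_coeff c b)) / c 0"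
  by auto
termination
proof (relation "measure (\<lambda>(c, m). total_degree m)", goal_cases)
  case (2 c m x a b)
  then have "a + b = m" "a \<noteq> 0"
    by (auto simp: splits_def)
  then have "total_degree m = total_degree a + total_degree b" "total_degree a \<noteq> 0"
    using total_degree_add total_degree_eq_0_iff by auto
  then show ?case
    by simp
qed auto

declare inverse_coeff.simps [simp del]

lemma mfps_right_inverse:
  fixes f :: "'a::field mfps"
  assumes "mfps_nth f 0 \<noteq> 0"
  shows "f * inverse f = 1"
proof -
  let ?c = "mfps_nth f"
  have "f * Abs_mfps (inverse_coeff ?c) = 1"
  proof (rule mfps_ext)
    fix m
    have "mfps_nth (f * Abs_mfps (inverse_coeff ?c)) m =
        (\<Sum>(a, b)\<in>splits m. ?c a * inverse_coeff ?c b)"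
      by (simp add: times_mfps.rep_eq)
    also have "\<dots> = ?c 0 * inverse_coeff ?c m +
        (\<Sum>(a, b)\<in>splits m - {(0, m)}. ?c a * inverse_coeff ?c b)"
      by (subst sum.remove[of _ "(0, m)"]) (auto simp: splits_iff)
    also have "\<dots> = (if m = 0 then 1 else 0)"
      using assms by (subst inverse_coeff.simps) simp
    finally show "mfps_nth (f * Abs_mfps (inverse_coeff ?c)) m = mfps_nth 1 m"
      by (simp add: one_mfps.rep_eq)
  qed
  then show ?thesis
    using mfps_inverse_unique by metis
qed

definition mfps_X :: "nat \<Rightarrow> 'a::comm_ring_1 mfps" where
  "mfps_X i = Abs_mfps (\<lambda>m. if m = Poly_Mapping.single i 1 then 1 else 0)"


section \<open>The free associative algebra\<close>

instantiation list :: (type) monoid_add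
begin

definition zero_list :: "'a list" where "0 = []"
definition plus_list :: "'a list \<Rightarrow> 'a list \<Rightarrow> 'a list" where "xs + ys = xs @ ys"

instance by standard (simp_all add: zero_list_def plus_list_def)

end

text \<open>
  \<open>K\<langle>X\<rangle>\<close> is the monoid algebra over \<open>K\<close> of the free monoid of words in \<open>x\<^sub>0, x\<^sub>1, \<dots>\<close>: with words
  added by concatenation, this is the ring of finitely supported functions on words.
\<close>

type_synonym 'k free_alg = "nat list \<Rightarrow>\<^sub>0 'k"

text \<open>The subalgebra \<open>K\<langle>x\<^sub>0, \<dots>, x\<^bsub>d-1\<^esub>\<rangle>\<close>.\<close>

definition free_algebra :: "nat \<Rightarrow> 'k::field free_alg ring" where
  "free_algebra d =
     \<lparr>carrier = {f. \<forall>w\<in>Poly_Mapping.keys f. set w \<subseteq> {..<d}},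
      monoid.mult = (*), one = 1, zero = 0, add = (+)\<rparr>"

definition scalar :: "'k::field \<Rightarrow> 'k free_alg" where
  "scalar c = Poly_Mapping.single [] c"

definition free_component :: "nat \<Rightarrow> (nat \<Rightarrow>\<^sub>0 nat) \<Rightarrow> 'k::field free_alg set" where
  "free_component d n =
     {f \<in> carrier (free_algebra d).
        \<forall>w\<in>Poly_Mapping.keys f. \<forall>i. count_list w i = Poly_Mapping.lookup n i}"


section \<open>Polynomial identities and relatively free algebras\<close>

text \<open>
  An algebra over the field \<open>'k\<close> is given by a record carrying its ring operations and its scalar
  multiplication.
\<close>

definition eval_poly ::
    "('k::field, 'r, 'm) module_scheme \<Rightarrow> (nat \<Rightarrow> 'r) \<Rightarrow> 'k free_alg \<Rightarrow> 'r" where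
  "eval_poly R \<rho> f =
     (\<Oplus>\<^bsub>R\<^esub>w\<in>Poly_Mapping.keys f.
       Poly_Mapping.lookup f w \<odot>\<^bsub>R\<^esub> foldr (\<lambda>i r. \<rho> i \<otimes>\<^bsub>R\<^esub> r) w \<one>\<^bsub>R\<^esub>)"

definition T_ideal :: "('k::field, 'r, 'm) module_scheme \<Rightarrow> 'k free_alg set" where
  "T_ideal R = {f. \<forall>\<rho>. range \<rho> \<subseteq> carrier R \<longrightarrow> eval_poly R \<rho> f = \<zero>\<^bsub>R\<^esub>}"

definition rel_free_ideal ::
    "nat \<Rightarrow> ('k::field, 'r, 'm) module_scheme \<Rightarrow> 'k free_alg set" where
  "rel_free_ideal d R = carrier (free_algebra d) \<inter> T_ideal R"

definition rel_free ::
    "nat \<Rightarrow> ('k::field, 'r, 'm) module_scheme \<Rightarrow> 'k free_alg set ring" where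
  "rel_free d R = free_algebra d Quot rel_free_ideal d R"

definition rel_free_class ::
    "nat \<Rightarrow> ('k::field, 'r, 'm) module_scheme \<Rightarrow> 'k free_alg \<Rightarrow> 'k free_alg set" where
  "rel_free_class d R f = rel_free_ideal d R +>\<^bsub>free_algebra d\<^esub> f"

definition rel_free_component ::
    "nat \<Rightarrow> ('k::field, 'r, 'm) module_scheme \<Rightarrow> (nat \<Rightarrow>\<^sub>0 nat) \<Rightarrow> 'k free_alg set set" where
  "rel_free_component d R n = rel_free_class d R ` free_component d n"

text \<open>
  The dimension over \<open>'k\<close> is taken over the isomorphic copy of \<open>'k\<close> formed by the scalars of
  the relatively free algebra.
\<close>

definition rel_free_dim ::
    "nat \<Rightarrow> ('k::field, 'r, 'm) module_scheme \<Rightarrow> (nat \<Rightarrow>\<^sub>0 nat) \<Rightarrow> nat" where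
  "rel_free_dim d R n =
     ring.dim (rel_free d R) (rel_free_class d R ` range scalar) (rel_free_component d R n)"

definition hilbert_series ::
    "nat \<Rightarrow> ('k::field, 'r, 'm) module_scheme \<Rightarrow> complex mfps" where
  "hilbert_series d R =
     Abs_mfps (\<lambda>n. if Poly_Mapping.keys n \<subseteq> {..<d} then of_nat (rel_free_dim d R n) else 0)"


section \<open>Upper triangular matrices\<close>

definition upper_triangular_algebra :: "nat \<Rightarrow> ('k::field, 'k mat) module" where
  "upper_triangular_algebra k =
     module_mat TYPE('k) k k \<lparr>carrier := {A \<in> carrier_mat k k. upper_triangular A}\<rparr>"

end

theory Submission
  imports
    Defs
    "HOL-Library.List_Lexorder"
    "HOL-Computational_Algebra.Polynomial"
begin

text \<open>
  The letters are read as numbers. A word is scanned from left to right; when a letter is followed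
  by a smaller one, this counts as a greedy descent and the scan starts afresh behind the smaller
  letter. The words with fewer than \<open>k\<close> greedy descents, here called normal, form a basis of
  \<open>F\<^sub>d(U\<^sub>k)\<close>. As they are homogeneous, the Hilbert series counts them.

  Normal words span. At a greedy descent, \<open>xy = [x,y] + yx\<close> with \<open>y < x\<close>, and the word with \<open>yx\<close>
  is lexicographically smaller. So a word with \<open>r\<close> greedy descents is, up to smaller words of the
  same multidegree, a product with \<open>r\<close> commutators among its factors (\<open>greedy_reduction\<close>). A
  commutator of upper triangular matrices is strictly upper triangular, so for \<open>r = k\<close> the product
  is an identity of \<open>U\<^sub>k\<close>, and induction on the finitely many words of the multidegree concludes
  (\<open>word_reduction\<close>).

  Normal words are independent. A word with \<open>s\<close> greedy descents is \<open>m\<^sub>0 i\<^sub>0 m\<^sub>1 i\<^sub>1 \<dots> m\<^sub>s\<close> with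
  sorted blocks \<open>m\<^sub>j\<close>; if it is normal then \<open>s < k\<close>. Substitute for \<open>x\<close> the bidiagonal matrix with
  indeterminates \<open>y(a, x)\<close> on the diagonal and, above the diagonal, \<open>1\<close> in row \<open>a\<close> if \<open>x = i\<^sub>a\<close> and \<open>0\<close>
  otherwise. The entry \<open>(0, s)\<close> of a word \<open>v\<close> is then a sum over all factorizations
  \<open>v = u\<^sub>0 i\<^sub>0 u\<^sub>1 i\<^sub>1 \<dots> u\<^sub>s\<close>, and each contributes the monomial that records the letters of every
  \<open>u\<^sub>j\<close>. The monomial of \<open>m\<^sub>0, \<dots>, m\<^sub>s\<close> occurs only if every \<open>u\<^sub>j\<close> is a permutation of \<open>m\<^sub>j\<close>, and
  then \<open>v\<close> is lexicographically at least the given word, because the blocks of the latter are sorted.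
  Hence in an identity that combines normal words, the coefficient of the largest one vanishes
  (\<open>T_ideal_normal_word_eq_0\<close>).

  Counting normal words. Let \<open>P\<close> be the series of the sorted words, \<open>\<sigma>\<close> the sum of the variables, \<open>D\<close>
  the series of the sorted words followed by a letter below their last one, and \<open>W\<^sub>k\<close> the series of
  the normal words. Cutting behind the first greedy descent gives \<open>W\<^bsub>k+1\<^esub> = P + D W\<^sub>k\<close>. A sorted word
  followed by an arbitrary letter is either counted by \<open>D\<close> or is itself a nonempty sorted word, so
  \<open>P \<sigma> = D + (P - 1)\<close>. It follows that \<open>(\<sigma> - 1) W\<^sub>k = (1 + (\<sigma> - 1) P)\<^sup>k - 1\<close>, which is the first
  formula; the second one is its binomial expansion.
\<close>


section \<open>Words and their greedy descents\<close>

definition multidegree :: "nat list \<Rightarrow> (nat \<Rightarrow>\<^sub>0 nat)" where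
  "multidegree w = (\<Sum>x\<leftarrow>w. Poly_Mapping.single x 1)"

lemma multidegree_simps [simp]:
  "multidegree [] = 0"
  "multidegree (x # w) = Poly_Mapping.single x 1 + multidegree w"
  "multidegree (u @ w) = multidegree u + multidegree w"
  by (simp_all add: multidegree_def)

lemma lookup_multidegree: "Poly_Mapping.lookup (multidegree w) i = count_list w i"
  by (induction w) (auto simp: lookup_add lookup_single when_def)

lemma multidegree_eq_iff: "multidegree w = n \<longleftrightarrow> (\<forall>i. count_list w i = Poly_Mapping.lookup n i)"
  by (auto simp: poly_mapping_eq_iff lookup_multidegree fun_eq_iff)

lemma keys_multidegree: "Poly_Mapping.keys (multidegree w) = set w"
  by (auto simp: in_keys_iff lookup_multidegree count_list_0_iff)

lemma total_degree_multidegree: "total_degree (multidegree w) = length w"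
  by (induction w) (simp_all add: total_degree_add, simp_all add: total_degree_def)

lemma finite_words_of_multidegree: "finite {w. multidegree w = n}"
proof (rule finite_subset)
  show "{w. multidegree w = n} \<subseteq> {w. set w \<subseteq> Poly_Mapping.keys n \<and> length w = total_degree n}"
    using keys_multidegree total_degree_multidegree by fastforce
  show "finite {w. set w \<subseteq> Poly_Mapping.keys n \<and> length w = total_degree n}"
    by (intro finite_lists_length_eq) simp
qed

text \<open>
  The letter below a descent is skipped, so that it cannot start another descent: the descents
  that are counted occupy disjoint pairs of adjacent letters.
\<close>

fun greedy_descents :: "nat list \<Rightarrow> nat" where
  "greedy_descents (x # y # w) =
     (if y < x then Suc (greedy_descents w) else greedy_descents (y # w))"
| "greedy_descents w = 0"

fun weave :: "'a list list \<Rightarrow> 'a list \<Rightarrow> 'a list" where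
  "weave (u # us) (i # is) = u @ i # weave us is"
| "weave (u # us) [] = u"
| "weave [] is = is"

text \<open>
  The letters \<open>is\<close> are those at the lower ends of the greedy descents, and the blocks \<open>ms\<close> are the
  sorted stretches between them. A block behind a lower end may be empty.
\<close>

lemma greedy_descents_decomposition:
  "\<exists>ms is. length is = greedy_descents w \<and> length ms = Suc (length is) \<and>
     (\<forall>m\<in>set ms. sorted m) \<and> weave ms is = w"
proof (induction w rule: greedy_descents.induct)
  case (1 x y w)
  show ?case
  proof (cases "y < x")
    case True
    then obtain ms "is" where "length is = greedy_descents w" "length ms = Suc (length is)"
      "\<forall>m\<in>set ms. sorted m" "weave ms is = w"
      using 1(1) by blast
    with True show ?thesis
      by (intro exI[of _ "[x] # ms"] exI[of _ "y # is"]) simp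
  next
    case False
    then obtain ms "is" where *: "length is = greedy_descents (y # w)" "length ms = Suc (length is)"
      "\<forall>m\<in>set ms. sorted m" "weave ms is = y # w"
      using 1(2) by blast
    then obtain m ms' where ms: "ms = m # ms'"
      by (cases ms) auto
    have "sorted (x # m)"
    proof (cases m)
      case (Cons z m')
      then have "z = y"
        using *(4) ms by (cases "is") auto
      then show ?thesis
        using False * ms Cons by auto
    qed simp
    moreover have "weave ((x # m) # ms') is = x # y # w"
      using *(4) ms by (cases "is") auto
    ultimately show ?thesis
      using * ms False by (intro exI[of _ "(x # m) # ms'"] exI[of _ "is"]) simp
  qed
next
  case ("2_1")
  then show ?case by (intro exI[of _ "[[]]"] exI[of _ "[]"]) simp
next
  case ("2_2" v)
  then show ?case by (intro exI[of _ "[[v]]"] exI[of _ "[]"]) simp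
qed

lemma append_le_append:
  fixes m u :: "'a::linorder list"
  assumes "length m = length u" "m \<le> u" "v \<le> w"
  shows "m @ v \<le> u @ w"
  using assms by (induction m u rule: list_induct2) auto

lemma sorted_le_permutation:
  fixes m u :: "'a::linorder list"
  assumes "sorted m" "mset m = mset u"
  shows "m \<le> u"
  using assms
proof (induction m arbitrary: u)
  case (Cons a m)
  then obtain b u' where u: "u = b # u'"
    by (cases u) auto
  have "b \<in> set (a # m)"
    using Cons.prems(2) u by (metis list.set_intros(1) set_mset_mset)
  then have "a < b \<or> a = b"
    using Cons.prems(1) by fastforce
  then show ?case
    using Cons u by auto
qed simp

text \<open>
  Sorting a block in place is a lexicographic decrease, since blocks at the same place have equal
  length. This makes the word with sorted blocks the least one with given block contents.
\<close>

lemma weave_le_weave: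
  fixes ms :: "'a::linorder list list"
  assumes "list_all2 (\<lambda>m u. sorted m \<and> mset m = mset u) ms us" "length ms = Suc (length is)"
  shows "weave ms is \<le> weave us is"
  using assms
proof (induction ms us arbitrary: "is" rule: list_all2_induct)
  case (Cons m ms u us)
  have mu: "length m = length u" "m \<le> u"
    using Cons.hyps sorted_le_permutation by (auto dest: mset_eq_length)
  show ?case
  proof (cases "is")
    case (Cons i "is'")
    then have "i # weave ms is' \<le> i # weave us is'"
      using Cons.IH Cons.prems by simp
    then show ?thesis
      using append_le_append[OF mu] Cons by simp
  qed (use mu in simp)
qed simp

section \<open>Factorizations of a word along given letters\<close>

definition weave_factors :: "'a list \<Rightarrow> 'a list \<Rightarrow> 'a list list set" where
  "weave_factors is v = {us. length us = Suc (length is) \<and> weave us is = v}"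

lemma weave_factors_Nil: "weave_factors is [] = (if is = [] then {[[]]} else {})"
proof (cases "is")
  case Nil
  have "length us = Suc 0 \<and> weave us [] = [] \<longleftrightarrow> us = [[]]" for us :: "'a list list"
    by (cases us) auto
  with Nil show ?thesis
    by (simp add: weave_factors_def)
next
  case (Cons i "is'")
  have "weave us (i # is') \<noteq> []" for us
    by (cases us) auto
  with Cons show ?thesis
    by (simp add: weave_factors_def)
qed

text \<open>
  The first letter \<open>x\<close> either belongs to the first block, or it is the first separating letter, and then
  the first block is empty. These are the two summands of the recursion for the entries of a
  product of bidiagonal matrices.
\<close>

lemma weave_factors_Cons:
  "weave_factors is (x # v) =
     (\<lambda>us. (x # hd us) # tl us) ` weave_factors is v \<union>
     (if is \<noteq> [] \<and> hd is = x then Cons [] ` weave_factors (tl is) v else {})"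
proof (intro equalityI subsetI)
  fix us assume "us \<in> weave_factors is (x # v)"
  then have len: "length us = Suc (length is)" and us: "weave us is = x # v"
    by (simp_all add: weave_factors_def)
  from len obtain u us' where [simp]: "us = u # us'"
    by (cases us) auto
  show "us \<in> (\<lambda>us. (x # hd us) # tl us) ` weave_factors is v \<union>
     (if is \<noteq> [] \<and> hd is = x then Cons [] ` weave_factors (tl is) v else {})"
  proof (cases u)
    case Nil
    then obtain "is'" where "is = x # is'" "weave us' is' = v"
      using us by (cases "is") auto
    with Nil len show ?thesis
      by (simp add: weave_factors_def)
  next
    case (Cons y u')
    then have "y = x" "weave (u' # us') is = v"
      using us by (cases "is"; simp)+
    then have "u' # us' \<in> weave_factors is v"
      using len by (simp add: weave_factors_def)
    then have "us \<in> (\<lambda>us. (x # hd us) # tl us) ` weave_factors is v"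
      by (rule rev_image_eqI) (simp add: Cons \<open>y = x\<close>)
    then show ?thesis ..
  qed
next
  fix us assume "us \<in> (\<lambda>us. (x # hd us) # tl us) ` weave_factors is v \<union>
     (if is \<noteq> [] \<and> hd is = x then Cons [] ` weave_factors (tl is) v else {})"
  then consider (push) us' where "us = (x # hd us') # tl us'" "us' \<in> weave_factors is v"
    | (new) us' where "is \<noteq> []" "hd is = x" "us = [] # us'" "us' \<in> weave_factors (tl is) v"
    by (auto simp del: split_paired_Ex split: if_splits)
  then show "us \<in> weave_factors is (x # v)"
  proof cases
    case (push us')
    then obtain u us'' where "us' = u # us''"
      by (cases us') (auto simp: weave_factors_def)
    with push show ?thesis
      by (cases "is") (simp_all add: weave_factors_def)
  next
    case (new us')
    then show ?thesis
      by (cases "is") (simp_all add: weave_factors_def)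
  qed
qed

lemma finite_weave_factors: "finite (weave_factors is v)"
proof (induction v arbitrary: "is")
  case (Cons x v)
  then show ?case
    unfolding weave_factors_Cons by (intro finite_UnI finite_imageI) simp_all
qed (simp add: weave_factors_Nil)

lemma sum_weave_factors_Cons:
  "(\<Sum>us\<in>weave_factors is (x # v). g us) =
     (\<Sum>us\<in>weave_factors is v. g ((x # hd us) # tl us)) +
     (if is \<noteq> [] \<and> hd is = x then \<Sum>us\<in>weave_factors (tl is) v. g ([] # us) else 0)"
proof -
  have inj: "inj_on (\<lambda>us. (x # hd us) # tl us) (weave_factors is v)"
  proof (rule inj_onI)
    fix us us' assume "us \<in> weave_factors is v" "us' \<in> weave_factors is v"
      "(x # hd us) # tl us = (x # hd us') # tl us'"
    then show "us = us'"
      by (cases us; cases us'; simp add: weave_factors_def)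
  qed
  have "(\<Sum>us\<in>weave_factors is (x # v). g us) =
     (\<Sum>us\<in>(\<lambda>us. (x # hd us) # tl us) ` weave_factors is v. g us) +
     (\<Sum>us\<in>(if is \<noteq> [] \<and> hd is = x then Cons [] ` weave_factors (tl is) v else {}). g us)"
    unfolding weave_factors_Cons by (rule sum.union_disjoint) (auto simp: finite_weave_factors)
  then show ?thesis
    by (simp add: sum.reindex[OF inj] sum.reindex o_def)
qed

section \<open>Coefficients of vanishing polynomials\<close>

text \<open>
  Over an infinite field a polynomial function in finitely many variables that vanishes everywhere
  has zero coefficients. The terms are indexed by an arbitrary finite set, and several of them may
  have the same exponents; their coefficients are added up. The induction adds one variable at a
  time and compares coefficients of a univariate polynomial.
\<close>

lemma coefficients_of_vanishing_polynomial:
  fixes c :: "'i \<Rightarrow> 'k::field_char_0" and e :: "'i \<Rightarrow> 'v \<Rightarrow> nat"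
  assumes "finite V" "finite I" "\<And>y. (\<Sum>i\<in>I. c i * (\<Prod>v\<in>V. y v ^ e i v)) = 0"
  shows "(\<Sum>i\<in>{i\<in>I. \<forall>v\<in>V. e i v = e\<^sub>0 v}. c i) = 0"
  using assms
proof (induction V arbitrary: I rule: finite_induct)
  case (insert v V)
  let ?J = "{i\<in>I. e i v = e\<^sub>0 v}"
  have "(\<Sum>i\<in>?J. c i * (\<Prod>u\<in>V. y u ^ e i u)) = 0" for y
  proof -
    define p where "p = (\<Sum>i\<in>I. monom (c i * (\<Prod>u\<in>V. y u ^ e i u)) (e i v))"
    have "poly p t = 0" for t
    proof -
      have *: "(\<Prod>u\<in>V. (y(v := t)) u ^ e i u) = (\<Prod>u\<in>V. y u ^ e i u)" for i
        using insert.hyps by (intro prod.cong) auto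
      have "poly p t = (\<Sum>i\<in>I. c i * (\<Prod>u\<in>insert v V. (y(v := t)) u ^ e i u))"
        unfolding p_def prod.insert[OF insert.hyps] *
        by (simp add: poly_sum poly_monom mult_ac)
      then show ?thesis
        using insert.prems by simp
    qed
    then have "p = 0"
      using poly_all_0_iff_0 by blast
    then have "0 = coeff p (e\<^sub>0 v)"
      by simp
    also have "\<dots> = (\<Sum>i\<in>I. if e i v = e\<^sub>0 v then c i * (\<Prod>u\<in>V. y u ^ e i u) else 0)"
      by (simp add: p_def coeff_sum)
    also have "\<dots> = (\<Sum>i\<in>?J. c i * (\<Prod>u\<in>V. y u ^ e i u))"
      by (rule sum.inter_filter[OF insert.prems(1), symmetric])
    finally show ?thesis ..
  qed
  then have "(\<Sum>i\<in>{i\<in>?J. \<forall>u\<in>V. e i u = e\<^sub>0 u}. c i) = 0"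
    using insert.prems(1) by (intro insert.IH) simp_all
  moreover have "{i\<in>?J. \<forall>u\<in>V. e i u = e\<^sub>0 u} = {i\<in>I. \<forall>u\<in>insert v V. e i u = e\<^sub>0 u}"
    by auto
  ultimately show ?case by metis
qed simp

section \<open>Linear functionals on the free algebra\<close>

definition linear_ext :: "('w \<Rightarrow> 'k) \<Rightarrow> ('w \<Rightarrow>\<^sub>0 'k::comm_ring_1) \<Rightarrow> 'k" where
  "linear_ext \<phi> f = (\<Sum>w\<in>Poly_Mapping.keys f. Poly_Mapping.lookup f w * \<phi> w)"

lemma linear_ext_eq:
  assumes "finite S" "Poly_Mapping.keys f \<subseteq> S"
  shows "linear_ext \<phi> f = (\<Sum>w\<in>S. Poly_Mapping.lookup f w * \<phi> w)"
  unfolding linear_ext_def using assms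
  by (intro sum.mono_neutral_left) (auto simp: in_keys_iff)

lemma linear_ext_zero [simp]: "linear_ext \<phi> 0 = 0"
  by (simp add: linear_ext_def)

lemma linear_ext_single [simp]: "linear_ext \<phi> (Poly_Mapping.single w c) = c * \<phi> w"
  by (subst linear_ext_eq[of "{w}"]) auto

lemma linear_ext_add [simp]: "linear_ext \<phi> (f + g) = linear_ext \<phi> f + linear_ext \<phi> g"
  using Poly_Mapping.keys_add[of f g]
  by (simp add: linear_ext_eq[of "Poly_Mapping.keys f \<union> Poly_Mapping.keys g"] lookup_add
      distrib_right sum.distrib)

lemma linear_ext_uminus [simp]: "linear_ext \<phi> (- f) = - linear_ext \<phi> f"
  using linear_ext_add[of \<phi> f "- f"] by (simp add: add_eq_0_iff del: linear_ext_add)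

lemma linear_ext_diff [simp]: "linear_ext \<phi> (f - g) = linear_ext \<phi> f - linear_ext \<phi> g"
  using linear_ext_add[of \<phi> f "- g"] by simp

lemma linear_ext_sum: "linear_ext \<phi> (sum F S) = (\<Sum>i\<in>S. linear_ext \<phi> (F i))"
  by (induction S rule: infinite_finite_induct) simp_all

lemma poly_mapping_sum_single:
  "(\<Sum>w\<in>Poly_Mapping.keys f. Poly_Mapping.single w (Poly_Mapping.lookup f w)) = f"
  by (rule poly_mapping_eqI)
    (simp add: lookup_sum lookup_single when_def sum.delta' in_keys_iff)

lemma linear_ext_mult:
  "linear_ext \<phi> (f * g) = linear_ext (\<lambda>u. linear_ext (\<lambda>v. \<phi> (u + v)) g) f"
proof -
  have "f * g = (\<Sum>u\<in>Poly_Mapping.keys f. \<Sum>v\<in>Poly_Mapping.keys g.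
      Poly_Mapping.single (u + v) (Poly_Mapping.lookup f u * Poly_Mapping.lookup g v))"
    by (subst (1) poly_mapping_sum_single[of f, symmetric],
        subst (1) poly_mapping_sum_single[of g, symmetric])
      (simp add: sum_product mult_single)
  then have "linear_ext \<phi> (f * g) = (\<Sum>u\<in>Poly_Mapping.keys f. \<Sum>v\<in>Poly_Mapping.keys g.
      Poly_Mapping.lookup f u * Poly_Mapping.lookup g v * \<phi> (u + v))"
    by (simp add: linear_ext_sum)
  then show ?thesis
    by (simp add: linear_ext_def sum_distrib_left mult_ac)
qed

lemma linear_ext_combination:
  "linear_ext (\<lambda>w. \<Sum>c\<in>S. a c * \<phi> c w) f = (\<Sum>c\<in>S. a c * linear_ext (\<phi> c) f)"
  by (subst (1) linear_ext_def, simp add: sum_distrib_left, subst sum.swap)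
    (simp add: linear_ext_def sum_distrib_left mult_ac)

lemma linear_ext_combination_right:
  "linear_ext (\<lambda>w. \<Sum>c\<in>S. \<phi> c w * a c) f = (\<Sum>c\<in>S. linear_ext (\<phi> c) f * a c)"
  using linear_ext_combination[of a \<phi> S f] by (simp add: mult_ac)

lemma linear_ext_scalar [simp]: "linear_ext \<phi> (scalar c * f) = c * linear_ext \<phi> f"
  by (simp add: scalar_def linear_ext_mult plus_list_def)

lemma keys_scalar_mult: "Poly_Mapping.keys (scalar c * f) \<subseteq> Poly_Mapping.keys f"
  using Poly_Mapping.keys_mult[of "scalar c" f] by (auto simp: scalar_def plus_list_def split: if_splits)

lemma keys_word_mult:
  "Poly_Mapping.keys (Poly_Mapping.single u c * f) \<subseteq> (@) u ` Poly_Mapping.keys f"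
  using Poly_Mapping.keys_mult[of "Poly_Mapping.single u c" f] by (auto simp: plus_list_def split: if_splits)

section \<open>Identities of upper triangular matrices\<close>

text \<open>
  Matrices substituted for the variables are given by their entries \<open>M x a b\<close>, with \<open>x\<close> the variable,
  \<open>a\<close> the row and \<open>b\<close> the column, numbered from \<open>0\<close>.
\<close>

definition upper_entries :: "(nat \<Rightarrow> nat \<Rightarrow> nat \<Rightarrow> 'k::zero) \<Rightarrow> bool" where
  "upper_entries M \<longleftrightarrow> (\<forall>x a b. b < a \<longrightarrow> M x a b = 0)"

fun word_entry ::
    "nat \<Rightarrow> (nat \<Rightarrow> nat \<Rightarrow> nat \<Rightarrow> 'k::comm_ring_1) \<Rightarrow> nat list \<Rightarrow> nat \<Rightarrow> nat \<Rightarrow> 'k" where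
  "word_entry k M [] a b = (if a = b then 1 else 0)"
| "word_entry k M (x # w) a b = (\<Sum>c<k. M x a c * word_entry k M w c b)"

lemma word_entry_append:
  "a < k \<Longrightarrow> word_entry k M (u @ v) a b = (\<Sum>c<k. word_entry k M u a c * word_entry k M v c b)"
proof (induction u arbitrary: a)
  case Nil
  have "(\<Sum>c<k. word_entry k M [] a c * word_entry k M v c b) =
      (\<Sum>c<k. if a = c then word_entry k M v c b else 0)"
    by (intro sum.cong) auto
  with Nil show ?case by simp
next
  case (Cons x u)
  have "(\<Sum>c<k. (\<Sum>e<k. M x a e * word_entry k M u e c) * word_entry k M v c b) =
      (\<Sum>e<k. \<Sum>c<k. M x a e * word_entry k M u e c * word_entry k M v c b)"
    by (subst sum.swap) (simp add: sum_distrib_right)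
  then show ?case
    using Cons.IH by (simp add: sum_distrib_left mult.assoc)
qed

lemma word_entry_upper:
  assumes "upper_entries M" "b < a"
  shows "word_entry k M w a b = 0"
  using assms(2)
proof (induction w arbitrary: a)
  case (Cons x w)
  have "M x a c * word_entry k M w c b = 0" for c
    using assms(1) Cons by (cases "c < a") (auto simp: upper_entries_def)
  then show ?case by simp
qed auto

lemma upper_commutator:
  fixes M :: "nat \<Rightarrow> nat \<Rightarrow> nat \<Rightarrow> 'k::comm_ring_1"
  assumes "upper_entries M" "c \<le> a"
  shows "word_entry k M [x, y] a c = word_entry k M [y, x] a c"
proof -
  have "M x a e * (\<Sum>i<k. M y e i * (if i = c then 1 else 0)) =
      M y a e * (\<Sum>i<k. M x e i * (if i = c then 1 else 0))" for e
  proof (cases "e < a \<or> c < e")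
    case True
    have "M z e i * (if i = c then 1 else 0) = 0" if "c < e" for z i
      using that assms(1) by (auto simp: upper_entries_def)
    with True show ?thesis
      using assms(1) by (auto simp: upper_entries_def)
  next
    case False
    with assms(2) have "e = a" "c = a" by auto
    then show ?thesis
      by (cases "a < k") (simp_all add: if_distrib[of "(*) _"] mult.commute cong: if_cong)
  qed
  then show ?thesis
    by simp
qed

lemma abelian_monoid_upper_triangular_algebra:
  "abelian_monoid (upper_triangular_algebra k :: ('k::field, 'k mat) module)"
  by (rule abelian_monoidI)
    (auto simp: upper_triangular_algebra_def module_mat_simps upper_triangular_def algebra_simps
      comm_add_mat)

lemma upper_triangular_algebra_simps:
  "carrier (upper_triangular_algebra k) = {A \<in> carrier_mat k k. upper_triangular A}"
  "monoid.mult (upper_triangular_algebra k) = (*)"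
  "\<one>\<^bsub>upper_triangular_algebra k\<^esub> = 1\<^sub>m k"
  "\<zero>\<^bsub>upper_triangular_algebra k\<^esub> = 0\<^sub>m k k"
  "add (upper_triangular_algebra k) = (+)"
  "module.smult (upper_triangular_algebra k) = (\<cdot>\<^sub>m)"
  by (simp_all add: upper_triangular_algebra_def module_mat_simps)

lemma finsum_upper_triangular_algebra:
  fixes g :: "'i \<Rightarrow> 'k::field mat"
  assumes "finite S" "g \<in> S \<rightarrow> carrier (upper_triangular_algebra k)"
  shows "finsum (upper_triangular_algebra k) g S = mat k k (\<lambda>(a, b). \<Sum>i\<in>S. g i $$ (a, b))"
  using assms
proof (induction S rule: finite_induct)
  case empty
  then show ?case
    by (auto simp: abelian_monoid.finsum_empty[OF abelian_monoid_upper_triangular_algebra]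
        upper_triangular_algebra_simps)
next
  case (insert i S)
  have "finsum (upper_triangular_algebra k) g (insert i S) =
      g i + mat k k (\<lambda>(a, b). \<Sum>i\<in>S. g i $$ (a, b))"
    using insert
    by (subst abelian_monoid.finsum_insert[OF abelian_monoid_upper_triangular_algebra])
      (auto simp: upper_triangular_algebra_simps(5))
  also have "\<dots> = mat k k (\<lambda>(a, b). \<Sum>i\<in>insert i S. g i $$ (a, b))"
    using insert by (intro eq_matI) (auto simp: upper_triangular_algebra_simps(1))
  finally show ?case .
qed

lemma foldr_matrix_word:
  fixes \<rho> :: "nat \<Rightarrow> 'k::field mat"
  assumes "range \<rho> \<subseteq> carrier (upper_triangular_algebra k)"
    and "\<And>x a b. a < k \<Longrightarrow> b < k \<Longrightarrow> M x a b = \<rho> x $$ (a, b)"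
  shows "foldr (\<lambda>i r. \<rho> i * r) w (1\<^sub>m k) = mat k k (\<lambda>(a, b). word_entry k M w a b)"
proof (induction w)
  case Nil
  show ?case by (auto simp: one_mat_def)
next
  case (Cons x w)
  have "\<rho> x \<in> carrier_mat k k"
    using assms(1) by (auto simp: upper_triangular_algebra_simps(1))
  with Cons show ?case
    by (intro eq_matI) (auto simp: scalar_prod_def assms(2) atLeast0LessThan intro!: sum.cong)
qed

lemma eval_poly_upper_triangular_algebra:
  fixes \<rho> :: "nat \<Rightarrow> 'k::field mat"
  assumes "range \<rho> \<subseteq> carrier (upper_triangular_algebra k)" "upper_entries M"
    and "\<And>x a b. a < k \<Longrightarrow> b < k \<Longrightarrow> M x a b = \<rho> x $$ (a, b)"
  shows "eval_poly (upper_triangular_algebra k) \<rho> f =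
    mat k k (\<lambda>(a, b). linear_ext (\<lambda>w. word_entry k M w a b) f)"
proof -
  let ?g = "\<lambda>w. Poly_Mapping.lookup f w \<cdot>\<^sub>m mat k k (\<lambda>(a, b). word_entry k M w a b)"
  have "eval_poly (upper_triangular_algebra k) \<rho> f =
      finsum (upper_triangular_algebra k) ?g (Poly_Mapping.keys f)"
    by (simp add: eval_poly_def upper_triangular_algebra_simps foldr_matrix_word[OF assms(1,3)])
  also have "\<dots> = mat k k (\<lambda>(a, b). \<Sum>w\<in>Poly_Mapping.keys f. ?g w $$ (a, b))"
    by (rule finsum_upper_triangular_algebra)
      (auto simp: upper_triangular_algebra_simps upper_triangular_def word_entry_upper[OF assms(2)])
  also have "\<dots> = mat k k (\<lambda>(a, b). linear_ext (\<lambda>w. word_entry k M w a b) f)"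
    by (intro eq_matI) (auto simp: linear_ext_def)
  finally show ?thesis .
qed

text \<open>
  Evaluation at matrices is replaced by the linear functionals on the free algebra that read off
  single entries. All further arguments use this description of the T-ideal.
\<close>

lemma T_ideal_upper_triangular_iff:
  fixes f :: "'k::field free_alg"
  shows "f \<in> T_ideal (upper_triangular_algebra k) \<longleftrightarrow>
    (\<forall>M. upper_entries M \<longrightarrow> (\<forall>a<k. \<forall>b<k. linear_ext (\<lambda>w. word_entry k M w a b) f = 0))"
    (is "_ \<longleftrightarrow> ?R")
proof
  assume f: "f \<in> T_ideal (upper_triangular_algebra k)"
  show ?R
  proof (intro allI impI)
    fix M :: "nat \<Rightarrow> nat \<Rightarrow> nat \<Rightarrow> 'k" and a b
    assume "upper_entries M" "a < k" "b < k"
    define \<rho> where "\<rho> x = mat k k (\<lambda>(a, b). M x a b)" for x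
    have "range \<rho> \<subseteq> carrier (upper_triangular_algebra k)"
      using \<open>upper_entries M\<close>
      by (auto simp: \<rho>_def upper_entries_def upper_triangular_algebra_simps upper_triangular_def)
    then have "0\<^sub>m k k = mat k k (\<lambda>(a, b). linear_ext (\<lambda>w. word_entry k M w a b) f)"
      using f \<open>upper_entries M\<close> eval_poly_upper_triangular_algebra[of \<rho> k M f]
      by (simp add: \<rho>_def T_ideal_def upper_triangular_algebra_simps)
    then have "0\<^sub>m k k $$ (a, b) =
        mat k k (\<lambda>(a, b). linear_ext (\<lambda>w. word_entry k M w a b) f) $$ (a, b)"
      by simp
    then show "linear_ext (\<lambda>w. word_entry k M w a b) f = 0"
      using \<open>a < k\<close> \<open>b < k\<close> by simp
  qed
next
  assume R: ?R
  have "eval_poly (upper_triangular_algebra k) \<rho> f = 0\<^sub>m k k"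
    if \<rho>: "range \<rho> \<subseteq> carrier (upper_triangular_algebra k)" for \<rho>
  proof -
    define M where "M x a b = (if a < k then \<rho> x $$ (a, b) else 0)" for x a b
    have "\<rho> x \<in> carrier_mat k k" "upper_triangular (\<rho> x)" for x
      using \<rho> by (auto simp: upper_triangular_algebra_simps)
    then have "upper_entries M"
      unfolding upper_entries_def M_def by (metis carrier_matD(1) upper_triangularD)
    then show ?thesis
      using eval_poly_upper_triangular_algebra[OF \<rho>, of M f] R by (auto simp: M_def)
  qed
  then show "f \<in> T_ideal (upper_triangular_algebra k)"
    by (simp add: T_ideal_def upper_triangular_algebra_simps)
qed

section \<open>Reduction to normal words\<close>

text \<open>
  The polynomial \<open>h\<close> is obtained from \<open>w\<close> on replacing \<open>r\<close> of the greedy descents \<open>xy\<close> by the commutator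
  \<open>[x,y]\<close>. Expanding the commutators gives \<open>w\<close> and words that are smaller at the first changed place.
  Each commutator shifts the nonzero entries of an upper triangular matrix up by one diagonal, so
  \<open>h\<close> takes values that vanish on the diagonals \<open>b - a < r\<close>.
\<close>

lemma greedy_reduction:
  fixes w :: "nat list"
  assumes "r \<le> greedy_descents w"
  shows "\<exists>h :: 'k::field free_alg.
    Poly_Mapping.keys (Poly_Mapping.single w 1 - h) \<subseteq> {v. v < w \<and> multidegree v = multidegree w} \<and>
    (\<forall>M a b. upper_entries M \<longrightarrow> a < k \<longrightarrow> b < k \<longrightarrow> b < a + r \<longrightarrow>
      linear_ext (\<lambda>v. word_entry k M v a b) h = 0)"
    (is "\<exists>h. ?P r w h")
  using assms
proof (induction w arbitrary: r rule: greedy_descents.induct)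
  case (1 x y w)
  show ?case
  proof (cases "r = 0")
    case True
    then show ?thesis
      by (intro exI[of _ "Poly_Mapping.single (x # y # w) 1"]) (simp add: word_entry_upper)
  next
    case r: False
    show ?thesis
    proof (cases "y < x")
      case True
      then have "r - 1 \<le> greedy_descents w"
        using "1.prems" by simp
      then obtain h where h: "?P (r - 1) w h"
        using "1.IH"(1)[OF True] by blast
      let ?xy = "Poly_Mapping.single [x, y] 1 :: 'k free_alg"
      let ?yx = "Poly_Mapping.single [y, x] 1 :: 'k free_alg"
      (* The difference to the word is xy (w - h) + yx h: the first part is smaller than xyw because
         w - h is smaller than w, the second one because y < x. *)
      define g where "g = (?xy - ?yx) * h"
      have "?xy * Poly_Mapping.single w 1 = Poly_Mapping.single (x # y # w) 1"
        by (simp add: mult_single plus_list_def)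
      then have "Poly_Mapping.single (x # y # w) 1 - g = ?xy * (Poly_Mapping.single w 1 - h) + ?yx * h"
        by (simp add: g_def algebra_simps)
      then have keys_g: "Poly_Mapping.keys (Poly_Mapping.single (x # y # w) 1 - g) \<subseteq>
          (@) [x, y] ` Poly_Mapping.keys (Poly_Mapping.single w 1 - h) \<union>
          (@) [y, x] ` Poly_Mapping.keys h"
        by (simp only:)
          (rule order_trans[OF Poly_Mapping.keys_add Un_mono[OF keys_word_mult keys_word_mult]])
      have deg_h: "multidegree v = multidegree w" if "v \<in> Poly_Mapping.keys h" for v
      proof (cases "v = w")
        case False
        with that have "v \<in> Poly_Mapping.keys (Poly_Mapping.single w 1 - h)"
          by (simp add: in_keys_iff lookup_minus lookup_single)
        with h show ?thesis by blast
      qed simp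
      have "Poly_Mapping.keys (Poly_Mapping.single (x # y # w) 1 - g) \<subseteq>
          {v. v < x # y # w \<and> multidegree v = multidegree (x # y # w)}"
      proof
        fix v assume "v \<in> Poly_Mapping.keys (Poly_Mapping.single (x # y # w) 1 - g)"
        then have "v \<in> (@) [x, y] ` Poly_Mapping.keys (Poly_Mapping.single w 1 - h) \<union>
            (@) [y, x] ` Poly_Mapping.keys h"
          by (rule subsetD[OF keys_g])
        then show "v \<in> {v. v < x # y # w \<and> multidegree v = multidegree (x # y # w)}"
        proof (elim UnE imageE)
          fix u assume "v = [x, y] @ u" "u \<in> Poly_Mapping.keys (Poly_Mapping.single w 1 - h)"
          moreover from this(2) h have "u < w \<and> multidegree u = multidegree w"
            by blast
          ultimately show ?thesis by simp
        next
          fix u assume "v = [y, x] @ u" "u \<in> Poly_Mapping.keys h"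
          with True deg_h[of u] show ?thesis by (simp add: add.left_commute)
        qed
      qed
      moreover have "linear_ext (\<lambda>v. word_entry k M v a b) g = 0"
        if M: "upper_entries M" and "a < k" "b < k" "b < a + r" for M a b
      proof -
        have "linear_ext (\<lambda>v. word_entry k M v a b) g =
            (\<Sum>c<k. word_entry k M [x, y] a c * linear_ext (\<lambda>v. word_entry k M v c b) h) -
            (\<Sum>c<k. word_entry k M [y, x] a c * linear_ext (\<lambda>v. word_entry k M v c b) h)"
          by (simp only: g_def left_diff_distrib linear_ext_diff linear_ext_mult linear_ext_single
              plus_list_def word_entry_append[OF \<open>a < k\<close>] linear_ext_combination mult_1)
        also have "\<dots> = (\<Sum>c<k. (word_entry k M [x, y] a c - word_entry k M [y, x] a c) *
            linear_ext (\<lambda>v. word_entry k M v c b) h)"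
          by (simp only: left_diff_distrib sum_subtractf)
        also have "\<dots> = 0"
        proof (intro sum.neutral ballI)
          fix c assume "c \<in> {..<k}"
          show "(word_entry k M [x, y] a c - word_entry k M [y, x] a c) *
              linear_ext (\<lambda>v. word_entry k M v c b) h = 0"
          proof (cases "c \<le> a")
            case True
            then show ?thesis
              using upper_commutator[OF M] by (metis diff_self mult_zero_left)
          next
            case False
            then have "b < c + (r - 1)"
              using that r by simp
            then show ?thesis
              using h M \<open>c \<in> {..<k}\<close> \<open>b < k\<close> by simp
          qed
        qed
        finally show ?thesis .
      qed
      ultimately show ?thesis by blast
    next
      case False
      then have "r \<le> greedy_descents (y # w)"
        using "1.prems" by simp
      then obtain h where h: "?P r (y # w) h"
        using "1.IH"(2)[OF False] by blast
      let ?x = "Poly_Mapping.single [x] 1 :: 'k free_alg"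
      have "Poly_Mapping.single (x # y # w) 1 - ?x * h = ?x * (Poly_Mapping.single (y # w) 1 - h)"
        by (simp add: algebra_simps mult_single plus_list_def)
      then have "Poly_Mapping.keys (Poly_Mapping.single (x # y # w) 1 - ?x * h) \<subseteq>
          (@) [x] ` Poly_Mapping.keys (Poly_Mapping.single (y # w) 1 - h)"
        by (simp only: keys_word_mult)
      then have "Poly_Mapping.keys (Poly_Mapping.single (x # y # w) 1 - ?x * h) \<subseteq>
          {v. v < x # y # w \<and> multidegree v = multidegree (x # y # w)}"
        using h by fastforce
      moreover have "linear_ext (\<lambda>v. word_entry k M v a b) (?x * h) = 0"
        if M: "upper_entries M" and "a < k" "b < k" "b < a + r" for M a b
      proof -
        have "linear_ext (\<lambda>v. word_entry k M v a b) (?x * h) =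
            (\<Sum>c<k. M x a c * linear_ext (\<lambda>v. word_entry k M v c b) h)"
          by (simp add: linear_ext_mult plus_list_def linear_ext_combination)
        also have "\<dots> = 0"
        proof (intro sum.neutral ballI)
          fix c assume "c \<in> {..<k}"
          show "M x a c * linear_ext (\<lambda>v. word_entry k M v c b) h = 0"
            using M h that \<open>c \<in> {..<k}\<close> by (cases "c < a") (simp_all add: upper_entries_def)
        qed
        finally show ?thesis .
      qed
      ultimately show ?thesis by blast
    qed
  qed
next
  case "2_1"
  then show ?case
    by (intro exI[of _ "Poly_Mapping.single [] 1"]) simp
next
  case ("2_2" x)
  then show ?case
    by (intro exI[of _ "Poly_Mapping.single [x] 1"]) (simp add: word_entry_upper del: word_entry.simps)
qed

lemma linear_span_mod_T_ideal:
  fixes f :: "'k::field free_alg"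
  assumes "\<And>w. w \<in> Poly_Mapping.keys f \<Longrightarrow> \<exists>g :: 'k free_alg. Poly_Mapping.keys g \<subseteq> B \<and>
    Poly_Mapping.single w 1 - g \<in> T_ideal (upper_triangular_algebra k)"
  shows "\<exists>g. Poly_Mapping.keys g \<subseteq> B \<and> f - g \<in> T_ideal (upper_triangular_algebra k)"
proof -
  obtain G :: "nat list \<Rightarrow> 'k free_alg" where G: "\<And>w. w \<in> Poly_Mapping.keys f \<Longrightarrow> Poly_Mapping.keys (G w) \<subseteq> B \<and>
      Poly_Mapping.single w 1 - G w \<in> T_ideal (upper_triangular_algebra k)"
    using assms by metis
  define g where "g = (\<Sum>w\<in>Poly_Mapping.keys f. scalar (Poly_Mapping.lookup f w) * G w)"
  have "Poly_Mapping.keys g \<subseteq> (\<Union>w\<in>Poly_Mapping.keys f. Poly_Mapping.keys (G w))"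
    unfolding g_def using keys_sum keys_scalar_mult by fastforce
  moreover have "f - g = (\<Sum>w\<in>Poly_Mapping.keys f.
      scalar (Poly_Mapping.lookup f w) * (Poly_Mapping.single w 1 - G w))"
    by (subst (1) poly_mapping_sum_single[of f, symmetric])
      (simp add: g_def right_diff_distrib scalar_def mult_single plus_list_def sum_subtractf)
  then have "f - g \<in> T_ideal (upper_triangular_algebra k)"
    using G by (simp add: T_ideal_upper_triangular_iff linear_ext_sum del: linear_ext_diff)
  ultimately show ?thesis
    using G by (meson UN_least order_trans)
qed

text \<open>
  A word with at least \<open>k\<close> greedy descents is congruent to a combination of smaller words because the
  polynomial of \<open>greedy_reduction\<close> for \<open>r = k\<close> vanishes on \<open>k \<times> k\<close> matrices. The lexicographic order
  is not well-founded on all words, but a multidegree has only finitely many of them, so a least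
  irreducible one would exist.
\<close>

lemma word_reduction:
  "\<exists>g :: 'k::field free_alg.
     Poly_Mapping.keys g \<subseteq> {v. multidegree v = multidegree w \<and> greedy_descents v < k} \<and>
     Poly_Mapping.single w 1 - g \<in> T_ideal (upper_triangular_algebra k)"
    (is "?P w")
proof (rule ccontr)
  assume "\<not> ?P w"
  define Bad where "Bad = {v. multidegree v = multidegree w \<and> \<not> ?P v}"
  have "finite Bad"
    by (rule finite_subset[OF _ finite_words_of_multidegree[of "multidegree w"]])
      (auto simp: Bad_def)
  moreover have "w \<in> Bad"
    using \<open>\<not> ?P w\<close> by (simp add: Bad_def)
  ultimately obtain u where u: "u \<in> Bad" and min: "\<And>v. v \<in> Bad \<Longrightarrow> u \<le> v"
    using Min_in Min_le by blast
  have "k \<le> greedy_descents u"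
  proof (rule ccontr)
    assume "\<not> k \<le> greedy_descents u"
    then have "?P u"
      by (intro exI[of _ "Poly_Mapping.single u 1"]) (simp add: T_ideal_upper_triangular_iff)
    with u show False
      unfolding Bad_def by blast
  qed
  then obtain h :: "'k free_alg" where h:
      "Poly_Mapping.keys (Poly_Mapping.single u 1 - h) \<subseteq> {v. v < u \<and> multidegree v = multidegree u}"
      "\<forall>M a b. upper_entries M \<longrightarrow> a < k \<longrightarrow> b < k \<longrightarrow> b < a + k \<longrightarrow>
        linear_ext (\<lambda>v. word_entry k M v a b) h = 0"
    using greedy_reduction by blast
  have "?P v" if "v \<in> Poly_Mapping.keys (Poly_Mapping.single u 1 - h)" for v
  proof -
    have "v < u" "multidegree v = multidegree w"
      using that h(1) u by (auto simp: Bad_def)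
    moreover from \<open>v < u\<close> have "v \<notin> Bad"
      using min[of v] by auto
    ultimately show ?thesis
      unfolding Bad_def by blast
  qed
  moreover have "multidegree v = multidegree u" if "v \<in> Poly_Mapping.keys (Poly_Mapping.single u 1 - h)" for v
    using that h(1) by auto
  ultimately obtain g where
      "Poly_Mapping.keys g \<subseteq> {v. multidegree v = multidegree u \<and> greedy_descents v < k}"
      "Poly_Mapping.single u 1 - h - g \<in> T_ideal (upper_triangular_algebra k)"
    using linear_span_mod_T_ideal[of "Poly_Mapping.single u 1 - h"
        "{v. multidegree v = multidegree u \<and> greedy_descents v < k}" k] by auto
  moreover from this h(2) have "Poly_Mapping.single u 1 - g \<in> T_ideal (upper_triangular_algebra k)"
    by (simp add: T_ideal_upper_triangular_iff)
  ultimately show False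
    using u by (auto simp: Bad_def)
qed

section \<open>Independence of normal words\<close>

fun block_weight :: "(nat \<times> nat \<Rightarrow> 'k::comm_monoid_mult) \<Rightarrow> nat \<Rightarrow> nat list list \<Rightarrow> 'k" where
  "block_weight y a [] = 1"
| "block_weight y a (u # us) = (\<Prod>x\<leftarrow>u. y (a, x)) * block_weight y (Suc a) us"

lemma prod_list_eq_prod_count_list:
  "finite L \<Longrightarrow> set u \<subseteq> L \<Longrightarrow> (\<Prod>x\<leftarrow>u. (g x :: 'k::comm_monoid_mult)) = (\<Prod>x\<in>L. g x ^ count_list u x)"
proof (induction u)
  case (Cons z u)
  have "(\<Prod>x\<in>L. g x ^ count_list (z # u) x) =
      (\<Prod>x\<in>L. (if z = x then g x else 1) * g x ^ count_list u x)"
    by (intro prod.cong) auto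
  then show ?case
    using Cons by (simp add: prod.distrib)
qed simp

lemma block_weight_eq:
  assumes "finite L" "\<forall>u\<in>set us. set u \<subseteq> L"
  shows "block_weight y a us = (\<Prod>(j, x)\<in>{..<length us} \<times> L. y (a + j, x) ^ count_list (us ! j) x)"
  using assms(2)
proof (induction us arbitrary: a)
  case (Cons u us)
  have "block_weight y a (u # us) = (\<Prod>x\<in>L. y (a, x) ^ count_list u x) *
      (\<Prod>j<length us. \<Prod>x\<in>L. y (Suc a + j, x) ^ count_list (us ! j) x)"
    using Cons by (simp add: prod_list_eq_prod_count_list[OF assms(1)] prod.cartesian_product)
  also have "\<dots> = (\<Prod>j<length (u # us). \<Prod>x\<in>L. y (a + j, x) ^ count_list ((u # us) ! j) x)"
    by (simp add: prod.lessThan_Suc_shift del: prod.lessThan_Suc)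
  finally show ?case
    by (simp add: prod.cartesian_product)
qed simp

definition bidiagonal :: "nat list \<Rightarrow> (nat \<times> nat \<Rightarrow> 'k) \<Rightarrow> nat \<Rightarrow> nat \<Rightarrow> nat \<Rightarrow> 'k::zero_neq_one" where
  "bidiagonal is y x a b =
     (if b = a then y (a, x) else if b = Suc a \<and> a < length is \<and> is ! a = x then 1 else 0)"

text \<open>
  A path from row \<open>a\<close> to column \<open>length is\<close> either stays, which contributes \<open>y (a, x)\<close>, or moves on to row
  \<open>a + 1\<close>, which is allowed only at the letter \<open>is ! a\<close>. So paths correspond to factorizations of the
  word along the letters that are still to come.
\<close>

lemma word_entry_bidiagonal:
  fixes y :: "nat \<times> nat \<Rightarrow> 'k::comm_ring_1"
  assumes "length is < k" "a \<le> length is"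
  shows "word_entry k (bidiagonal is y) v a (length is) =
    (\<Sum>us\<in>weave_factors (drop a is) v. block_weight y a us)"
  using assms(2)
proof (induction v arbitrary: a)
  case Nil
  then show ?case
    by (auto simp: weave_factors_Nil)
next
  case (Cons x v)
  let ?E = "\<lambda>a. word_entry k (bidiagonal is y) v a (length is)"
  let ?jump = "a < length is \<and> is ! a = x"
  have "word_entry k (bidiagonal is y) (x # v) a (length is) =
      (\<Sum>c<k. (if c = a then y (a, x) * ?E c else 0) +
        (if c = Suc a then if ?jump then ?E c else 0 else 0))"
    unfolding word_entry.simps by (intro sum.cong) (auto simp: bidiagonal_def)
  also have "\<dots> = y (a, x) * ?E a + (if ?jump then ?E (Suc a) else 0)"
    using assms(1) Cons.prems by (simp add: sum.distrib)
  also have "y (a, x) * ?E a = (\<Sum>us\<in>weave_factors (drop a is) v. y (a, x) * block_weight y a us)"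
    using Cons by (simp add: sum_distrib_left)
  also have "\<dots> = (\<Sum>us\<in>weave_factors (drop a is) v. block_weight y a ((x # hd us) # tl us))"
  proof (rule sum.cong)
    fix us assume "us \<in> weave_factors (drop a is) v"
    then show "y (a, x) * block_weight y a us = block_weight y a ((x # hd us) # tl us)"
      by (cases us) (simp_all add: weave_factors_def mult.assoc)
  qed simp
  also have "(if ?jump then ?E (Suc a) else 0) =
      (if drop a is \<noteq> [] \<and> hd (drop a is) = x
       then \<Sum>us\<in>weave_factors (tl (drop a is)) v. block_weight y a ([] # us) else 0)"
    using Cons.IH[of "Suc a"] by (auto simp: hd_drop_conv_nth tl_drop drop_Suc)
  finally show ?case
    by (simp only: sum_weave_factors_Cons)
qed

lemma set_weave_subset: "length us = Suc (length is) \<Longrightarrow> u \<in> set us \<Longrightarrow> set u \<subseteq> set (weave us is)"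
  by (induction us "is" rule: weave.induct) auto

text \<open>
  Take the largest word \<open>w\<close> of \<open>f\<close> and its blocks \<open>ms\<close>. All words of \<open>f\<close> that contribute to the
  monomial of \<open>ms\<close> are at least \<open>w\<close>, hence equal to \<open>w\<close>. The coefficient of this monomial is therefore a
  positive multiple of the coefficient of \<open>w\<close>, and characteristic \<open>0\<close> allows dividing by it.
\<close>

lemma T_ideal_normal_word_eq_0:
  fixes f :: "'k::field_char_0 free_alg"
  assumes f: "f \<in> T_ideal (upper_triangular_algebra k)"
    and normal: "\<And>w. w \<in> Poly_Mapping.keys f \<Longrightarrow> greedy_descents w < k"
  shows "f = 0"
proof (rule ccontr)
  assume "f \<noteq> 0"
  define w where "w = Max (Poly_Mapping.keys f)"
  have w: "w \<in> Poly_Mapping.keys f" and w_max: "\<And>v. v \<in> Poly_Mapping.keys f \<Longrightarrow> v \<le> w"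
    using \<open>f \<noteq> 0\<close> by (simp_all add: w_def)
  obtain ms "is" where len_is: "length is = greedy_descents w"
    and len_ms: "length ms = Suc (length is)" and sorted: "\<forall>m\<in>set ms. sorted m"
    and weave: "weave ms is = w"
    using greedy_descents_decomposition by blast
  define s where "s = length is"
  define L where "L = (\<Union>v\<in>Poly_Mapping.keys f. set v)"
  define V where "V = {..<Suc s} \<times> L"
  (* A factorization determines its word, so one index set serves for all words of f. *)
  define I where "I = (\<Union>v\<in>Poly_Mapping.keys f. weave_factors is v)"
  define e where "e = (\<lambda>(us :: nat list list) (j, x). count_list (us ! j) x)"
  define c where "c us = Poly_Mapping.lookup f (weave us is)" for us
  have "finite L" "finite V" "finite I"
    by (simp_all add: L_def V_def I_def finite_weave_factors)
  have I_iff: "us \<in> I \<longleftrightarrow> length us = Suc s \<and> weave us is \<in> Poly_Mapping.keys f" for us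
    by (auto simp: I_def weave_factors_def s_def)
  have letters: "\<forall>u\<in>set us. set u \<subseteq> L" if "us \<in> I" for us
    using that set_weave_subset[of us "is"] by (fastforce simp: I_iff s_def L_def)
  have "(\<Sum>us\<in>I. c us * (\<Prod>v\<in>V. y v ^ e us v)) = 0" for y
  proof -
    have "upper_entries (bidiagonal is y)"
      by (auto simp: upper_entries_def bidiagonal_def)
    then have "0 = linear_ext (\<lambda>v. word_entry k (bidiagonal is y) v 0 s) f"
      using f normal[OF w] by (simp add: T_ideal_upper_triangular_iff s_def len_is)
    also have "\<dots> = (\<Sum>v\<in>Poly_Mapping.keys f. \<Sum>us\<in>weave_factors is v.
        Poly_Mapping.lookup f v * block_weight y 0 us)"
      using normal[OF w] word_entry_bidiagonal[of "is" k 0 y]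
      by (simp add: linear_ext_def s_def len_is sum_distrib_left)
    also have "\<dots> = (\<Sum>v\<in>Poly_Mapping.keys f. \<Sum>us\<in>weave_factors is v. c us * block_weight y 0 us)"
      by (intro sum.cong) (auto simp: c_def weave_factors_def)
    also have "\<dots> = (\<Sum>us\<in>I. c us * block_weight y 0 us)"
      unfolding I_def
      by (intro sum.UNION_disjoint[symmetric]) (auto simp: finite_weave_factors, auto simp: weave_factors_def)
    also have "\<dots> = (\<Sum>us\<in>I. c us * (\<Prod>v\<in>V. y v ^ e us v))"
    proof (intro sum.cong refl)
      fix us assume "us \<in> I"
      then show "c us * block_weight y 0 us = c us * (\<Prod>v\<in>V. y v ^ e us v)"
        using block_weight_eq[OF \<open>finite L\<close> letters, of us y 0]
        by (simp add: V_def e_def I_iff case_prod_unfold)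
    qed
    finally show ?thesis ..
  qed
  then have "(\<Sum>us\<in>{us\<in>I. \<forall>v\<in>V. e us v = e ms v}. c us) = 0"
    by (intro coefficients_of_vanishing_polynomial \<open>finite V\<close> \<open>finite I\<close>)
  moreover have "c us = Poly_Mapping.lookup f w" if "us \<in> I" "\<forall>v\<in>V. e us v = e ms v" for us
  proof -
    have "ms \<in> I"
      using w weave len_ms by (simp add: I_iff s_def)
    have "mset (ms ! j) = mset (us ! j)" if "j < Suc s" for j
    proof (rule multiset_eqI)
      fix x
      show "count (mset (ms ! j)) x = count (mset (us ! j)) x"
      proof (cases "x \<in> L")
        case True
        then have "e us (j, x) = e ms (j, x)"
          using \<open>\<forall>v\<in>V. e us v = e ms v\<close> that by (auto simp: V_def)
        then show ?thesis
          by (simp add: e_def count_mset)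
      next
        case False
        have "ms ! j \<in> set ms" "us ! j \<in> set us"
          using \<open>ms \<in> I\<close> \<open>us \<in> I\<close> that by (simp_all add: I_iff)
        then have "x \<notin> set (ms ! j)" "x \<notin> set (us ! j)"
          using letters[OF \<open>ms \<in> I\<close>] letters[OF \<open>us \<in> I\<close>] False by blast+
        then show ?thesis
          by (metis count_mset_0_iff)
      qed
    qed
    then have "list_all2 (\<lambda>m u. sorted m \<and> mset m = mset u) ms us"
      using sorted \<open>ms \<in> I\<close> \<open>us \<in> I\<close> by (auto simp: list_all2_conv_all_nth I_iff)
    then have "w \<le> weave us is"
      using weave_le_weave len_ms weave by blast
    moreover have "weave us is \<le> w"
      using w_max \<open>us \<in> I\<close> by (simp add: I_iff)
    ultimately show ?thesis
      by (simp add: c_def)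
  qed
  ultimately have "of_nat (card {us\<in>I. \<forall>v\<in>V. e us v = e ms v}) * Poly_Mapping.lookup f w = 0"
    by simp
  moreover have "ms \<in> {us\<in>I. \<forall>v\<in>V. e us v = e ms v}"
    using w weave len_ms by (simp add: I_iff s_def)
  then have "card {us\<in>I. \<forall>v\<in>V. e us v = e ms v} \<noteq> 0"
    using \<open>finite I\<close> by auto
  ultimately show False
    using w by (simp add: in_keys_iff)
qed

section \<open>Dimensions of the homogeneous components\<close>

lemma linear_ext_word_entry_mult:
  assumes "a < k"
  shows "linear_ext (\<lambda>w. word_entry k M w a b) (f * g) =
    (\<Sum>c<k. linear_ext (\<lambda>w. word_entry k M w a c) f * linear_ext (\<lambda>w. word_entry k M w c b) g)"
  by (simp add: linear_ext_mult plus_list_def word_entry_append[OF assms] linear_ext_combination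
      linear_ext_combination_right)

lemma free_algebra_simps:
  "carrier (free_algebra d) = {f. \<forall>w\<in>Poly_Mapping.keys f. set w \<subseteq> {..<d}}"
  "x \<otimes>\<^bsub>free_algebra d\<^esub> y = x * y"
  "\<one>\<^bsub>free_algebra d\<^esub> = 1"
  "\<zero>\<^bsub>free_algebra d\<^esub> = 0"
  "x \<oplus>\<^bsub>free_algebra d\<^esub> y = x + y"
  by (simp_all add: free_algebra_def)

lemma free_algebra_closed:
  "f \<in> carrier (free_algebra d) \<Longrightarrow> g \<in> carrier (free_algebra d) \<Longrightarrow> f + g \<in> carrier (free_algebra d)"
  "f \<in> carrier (free_algebra d) \<Longrightarrow> g \<in> carrier (free_algebra d) \<Longrightarrow> f * g \<in> carrier (free_algebra d)"
  "f \<in> carrier (free_algebra d) \<Longrightarrow> - f \<in> carrier (free_algebra d)"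
proof -
  show "f + g \<in> carrier (free_algebra d)"
    if "f \<in> carrier (free_algebra d)" "g \<in> carrier (free_algebra d)"
    using that Poly_Mapping.keys_add[of f g] unfolding free_algebra_simps by blast
  show "f * g \<in> carrier (free_algebra d)"
    if fg: "f \<in> carrier (free_algebra d)" "g \<in> carrier (free_algebra d)"
  proof -
    have "set w \<subseteq> {..<d}" if w: "w \<in> Poly_Mapping.keys (f * g)" for w
    proof -
      obtain u v where "w = u @ v" "u \<in> Poly_Mapping.keys f" "v \<in> Poly_Mapping.keys g"
        using subsetD[OF Poly_Mapping.keys_mult w] by (auto simp: plus_list_def)
      with fg show ?thesis
        by (simp add: free_algebra_simps)
    qed
    then show ?thesis
      by (simp add: free_algebra_simps)
  qed
  show "- f \<in> carrier (free_algebra d)" if "f \<in> carrier (free_algebra d)"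
    using that by (simp add: free_algebra_simps in_keys_iff)
qed

lemma ring_free_algebra: "ring (free_algebra d :: 'k::field free_alg ring)"
proof (rule ringI)
  show "abelian_group (free_algebra d :: 'k free_alg ring)"
  proof (rule abelian_groupI)
    fix f :: "'k free_alg" assume "f \<in> carrier (free_algebra d)"
    then show "\<exists>g\<in>carrier (free_algebra d). g \<oplus>\<^bsub>free_algebra d\<^esub> f = \<zero>\<^bsub>free_algebra d\<^esub>"
      using free_algebra_closed(3) by (intro bexI[of _ "- f"]) (simp_all add: free_algebra_simps)
  qed (simp_all add: free_algebra_closed free_algebra_simps(2-) add_ac, simp add: free_algebra_simps)
  show "monoid (free_algebra d :: 'k free_alg ring)"
    by (rule monoidI)
      (simp_all add: free_algebra_closed free_algebra_simps(2-) mult.assoc,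
        simp add: free_algebra_simps zero_list_def)
qed (simp_all add: free_algebra_simps algebra_simps)

lemma a_inv_free_algebra:
  assumes "f \<in> carrier (free_algebra d)"
  shows "\<ominus>\<^bsub>free_algebra d\<^esub> f = - f"
proof -
  interpret ring "free_algebra d :: 'a free_alg ring"
    by (rule ring_free_algebra)
  show ?thesis
    using assms free_algebra_closed(3)[OF assms] by (intro minus_equality) (simp_all add: free_algebra_simps(2-))
qed

lemma scalar_simps:
  "scalar 0 = 0" "scalar 1 = 1" "scalar (a + b) = scalar a + scalar b"
  "scalar (a * b) = scalar a * scalar b" "scalar (- a) = - scalar a"
  "scalar c * Poly_Mapping.single w e = Poly_Mapping.single w (c * e)"
proof -
  show "scalar 1 = 1"
    by (simp only: scalar_def zero_list_def[symmetric] single_one)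
qed (simp_all add: scalar_def single_add single_uminus mult_single plus_list_def)

lemma scalar_closed: "scalar c \<in> carrier (free_algebra d)"
  by (auto simp: scalar_def free_algebra_simps)

lemma subfield_scalars: "subfield (range scalar) (free_algebra d :: 'k::field free_alg ring)"
proof -
  interpret ring "free_algebra d :: 'k free_alg ring"
    by (rule ring_free_algebra)
  have inj: "scalar a = scalar b \<longleftrightarrow> a = b" for a b :: 'k
    by (metis lookup_single_eq scalar_def)
  show ?thesis
  proof (rule subfieldI)
    show "subcring (range scalar) (free_algebra d :: 'k free_alg ring)"
    proof (rule subcringI, rule subringI)
      show "\<one>\<^bsub>free_algebra d\<^esub> \<in> range (scalar :: 'k \<Rightarrow> _)"
        using scalar_simps(2) by (metis free_algebra_simps(3) rangeI)
      fix f g :: "'k free_alg" assume "f \<in> range scalar" "g \<in> range scalar"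
      then obtain a b where f: "f = scalar a" and g: "g = scalar b"
        by blast
      show "\<ominus>\<^bsub>free_algebra d\<^esub> f \<in> range scalar"
        unfolding f a_inv_free_algebra[OF scalar_closed] scalar_simps(5)[symmetric] by blast
      show "f \<otimes>\<^bsub>free_algebra d\<^esub> g \<in> range scalar"
        unfolding f g free_algebra_simps scalar_simps(4)[symmetric] by blast
      show "f \<oplus>\<^bsub>free_algebra d\<^esub> g \<in> range scalar"
        unfolding f g free_algebra_simps scalar_simps(3)[symmetric] by blast
      show "f \<otimes>\<^bsub>free_algebra d\<^esub> g = g \<otimes>\<^bsub>free_algebra d\<^esub> f"
        unfolding f g free_algebra_simps scalar_simps(4)[symmetric] by (simp only: mult.commute)
    qed (auto simp: scalar_closed)
    show "Units (free_algebra d \<lparr>carrier := range scalar\<rparr>) =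
        range (scalar :: 'k \<Rightarrow> _) - {\<zero>\<^bsub>free_algebra d\<^esub>}"
    proof (intro equalityI subsetI)
      fix u :: "'k free_alg"
      assume "u \<in> Units (free_algebra d \<lparr>carrier := range scalar\<rparr>)"
      then show "u \<in> range scalar - {\<zero>\<^bsub>free_algebra d\<^esub>}"
        by (auto simp: Units_def free_algebra_simps)
    next
      fix u :: "'k free_alg"
      assume "u \<in> range scalar - {\<zero>\<^bsub>free_algebra d\<^esub>}"
      then obtain c where "u = scalar c" "c \<noteq> 0"
        using scalar_simps(1) by (auto simp: free_algebra_simps)
      then have "scalar (inverse c) * u = 1" "u * scalar (inverse c) = 1"
        by (simp_all add: scalar_simps(2) flip: scalar_simps(4))
      with \<open>u = scalar c\<close> show "u \<in> Units (free_algebra d \<lparr>carrier := range scalar\<rparr>)"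
        by (auto simp: Units_def free_algebra_simps)
    qed
  qed
qed

lemma ideal_rel_free_ideal:
  "ideal (rel_free_ideal d (upper_triangular_algebra k :: ('k::field, 'k mat) module)) (free_algebra d)"
proof (rule idealI[OF ring_free_algebra])
  interpret ring "free_algebra d :: 'k free_alg ring"
    by (rule ring_free_algebra)
  show "subgroup (rel_free_ideal d (upper_triangular_algebra k :: ('k, 'k mat) module))
      (add_monoid (free_algebra d))"
  proof (rule subgroup.intro)
    fix f :: "'k free_alg"
    assume f: "f \<in> rel_free_ideal d (upper_triangular_algebra k :: ('k, 'k mat) module)"
    then have "inv\<^bsub>add_monoid (free_algebra d)\<^esub> f = - f"
      using a_inv_free_algebra[of f d] by (simp add: rel_free_ideal_def a_inv_def)
    with f show "inv\<^bsub>add_monoid (free_algebra d)\<^esub> f \<in>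
        rel_free_ideal d (upper_triangular_algebra k :: ('k, 'k mat) module)"
      by (simp add: rel_free_ideal_def T_ideal_upper_triangular_iff free_algebra_closed)
  qed (auto simp: rel_free_ideal_def T_ideal_upper_triangular_iff free_algebra_closed free_algebra_simps(2-),
      auto simp: free_algebra_simps)
qed (auto simp: rel_free_ideal_def T_ideal_upper_triangular_iff free_algebra_closed
    free_algebra_simps(2-) linear_ext_word_entry_mult)

definition linear_comb :: "'k list \<Rightarrow> 'w list \<Rightarrow> 'w \<Rightarrow>\<^sub>0 'k::comm_ring_1" where
  "linear_comb cs ws = (\<Sum>(c, w)\<leftarrow>zip cs ws. Poly_Mapping.single w c)"

lemma linear_comb_simps [simp]:
  "linear_comb [] ws = 0" "linear_comb cs [] = 0"
  "linear_comb (c # cs) (w # ws) = Poly_Mapping.single w c + linear_comb cs ws"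
  by (simp_all add: linear_comb_def)

lemma keys_linear_comb: "Poly_Mapping.keys (linear_comb cs ws) \<subseteq> set ws"
proof (induction cs ws rule: list_induct2')
  case (4 c cs w ws)
  then show ?case
    using Poly_Mapping.keys_add[of "Poly_Mapping.single w c" "linear_comb cs ws"]
    by (auto split: if_splits)
qed simp_all

lemma lookup_linear_comb:
  "distinct ws \<Longrightarrow> i < length cs \<Longrightarrow> i < length ws \<Longrightarrow> Poly_Mapping.lookup (linear_comb cs ws) (ws ! i) = cs ! i"
proof (induction cs ws arbitrary: i rule: list_induct2')
  case (4 c cs w ws)
  have "Poly_Mapping.lookup (linear_comb cs ws) w = 0"
    using 4 keys_linear_comb[of cs ws] by (auto simp: in_keys_iff)
  with 4 show ?case
    by (cases i) (auto simp: lookup_add lookup_single when_def)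
qed simp_all

lemma linear_comb_lookup:
  assumes "distinct ws" "Poly_Mapping.keys f \<subseteq> set ws"
  shows "linear_comb (map (Poly_Mapping.lookup f) ws) ws = f"
proof (rule poly_mapping_eqI)
  fix w
  show "Poly_Mapping.lookup (linear_comb (map (Poly_Mapping.lookup f) ws) ws) w = Poly_Mapping.lookup f w"
  proof (cases "w \<in> set ws")
    case True
    then show ?thesis
      using lookup_linear_comb[OF assms(1), of _ "map (Poly_Mapping.lookup f) ws"]
      by (auto simp: in_set_conv_nth)
  next
    case False
    then show ?thesis
      using assms keys_linear_comb by (metis in_keys_iff subsetD)
  qed
qed

text \<open>
  The classes of the normal words of multidegree \<open>n\<close> are a basis of the component: they are independent
  by \<open>T_ideal_normal_word_eq_0\<close> and they span by \<open>word_reduction\<close>. The scalars form a subfield of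
  the quotient because \<open>1\<close> is not an identity, and this is where \<open>k \<ge> 1\<close> is needed.
\<close>

lemma rel_free_dim_upper_triangular:
  fixes n :: "nat \<Rightarrow>\<^sub>0 nat"
  assumes "k \<ge> 1" "Poly_Mapping.keys n \<subseteq> {..<d}"
  shows "rel_free_dim d (upper_triangular_algebra k :: ('k::field_char_0, 'k mat) module) n =
    card {w. multidegree w = n \<and> greedy_descents w < k}"
proof -
  let ?F = "free_algebra d :: 'k free_alg ring"
  let ?U = "upper_triangular_algebra k :: ('k, 'k mat) module"
  let ?Q = "rel_free d ?U"
  let ?\<pi> = "rel_free_class d ?U"
  interpret F: ring ?F
    by (rule ring_free_algebra)
  interpret I: ideal "rel_free_ideal d ?U" ?F
    by (rule ideal_rel_free_ideal)
  interpret \<pi>: ring_hom_ring ?F ?Q ?\<pi>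
    using I.rcos_ring_hom_ring by (simp add: rel_free_def rel_free_class_def[abs_def])
  have \<pi>_eq_iff: "?\<pi> f = ?\<pi> g \<longleftrightarrow> f - g \<in> T_ideal ?U"
    if "f \<in> carrier ?F" "g \<in> carrier ?F" for f g
  proof -
    have "f - g \<in> carrier ?F"
      using free_algebra_closed(1)[OF that(1) free_algebra_closed(3)[OF that(2)]] by simp
    moreover have "f \<ominus>\<^bsub>?F\<^esub> g = f - g"
      by (simp add: a_minus_def a_inv_free_algebra[OF that(2)] free_algebra_simps)
    ultimately show ?thesis
      using F.quotient_eq_iff_same_a_r_cos[OF I.ideal_axioms that]
      by (simp add: rel_free_class_def rel_free_ideal_def)
  qed
  have zero: "\<zero>\<^bsub>?Q\<^esub> = ?\<pi> 0"
    using \<pi>.hom_zero by (simp add: free_algebra_simps)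
  have "\<one>\<^bsub>?Q\<^esub> \<noteq> \<zero>\<^bsub>?Q\<^esub>"
  proof -
    have "(1 :: 'k free_alg) - 0 \<notin> T_ideal ?U"
    proof
      assume "(1 :: 'k free_alg) - 0 \<in> T_ideal ?U"
      (* The entry (0, 0) of the identity matrix is nonzero. *)
      then have "linear_ext (\<lambda>w. word_entry k (\<lambda>_ _ _. 0) w 0 0) (Poly_Mapping.single 0 1 :: 'k free_alg) = 0"
        using assms(1) by (subst (asm) T_ideal_upper_triangular_iff) (simp add: upper_entries_def)
      then show False
        by (simp add: zero_list_def del: single_one)
    qed
    then have "?\<pi> 1 \<noteq> ?\<pi> 0"
      by (subst \<pi>_eq_iff) (auto simp: free_algebra_simps zero_list_def)
    then show ?thesis
      using \<pi>.hom_one zero by (simp add: free_algebra_simps)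
  qed
  then have K: "subfield (?\<pi> ` range scalar) ?Q"
    by (rule \<pi>.img_is_subfield(2)[OF subfield_scalars])
  let ?N = "{w. multidegree w = n \<and> greedy_descents w < k}"
  have "finite ?N"
    by (rule finite_subset[OF _ finite_words_of_multidegree[of n]]) auto
  then obtain ws where ws: "set ws = ?N" "distinct ws"
    using finite_distinct_list by blast
  have letters: "set w \<subseteq> {..<d}" if "multidegree w = n" for w
    using assms(2) that keys_multidegree by blast
  have closed: "f \<in> carrier ?F" if "Poly_Mapping.keys f \<subseteq> {w. multidegree w = n}" for f :: "'k free_alg"
    using that letters by (auto simp: free_algebra_simps)
  define Us where "Us = map (\<lambda>w. ?\<pi> (Poly_Mapping.single w 1)) ws"
  have Us_closed: "set Us \<subseteq> carrier ?Q"
    unfolding Us_def using ws letters by (auto intro!: \<pi>.hom_closed simp: free_algebra_simps)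
  have comb_closed: "linear_comb cs vs \<in> carrier ?F" if "set vs \<subseteq> set ws" for cs :: "'k list" and vs
    using keys_linear_comb[of cs vs] that ws by (intro closed) auto
  have combine: "\<pi>.S.combine (map (\<lambda>c. ?\<pi> (scalar c)) cs) (map (\<lambda>w. ?\<pi> (Poly_Mapping.single w 1)) vs) =
      ?\<pi> (linear_comb cs vs)" if "set vs \<subseteq> set ws" for cs vs
    using that
  proof (induction cs vs rule: list_induct2')
    case (4 c cs w vs)
    have w: "Poly_Mapping.single w (e :: 'k) \<in> carrier ?F" for e
      using 4(2) ws by (intro closed) auto
    have "?\<pi> (scalar c) \<otimes>\<^bsub>?Q\<^esub> ?\<pi> (Poly_Mapping.single w 1) = ?\<pi> (Poly_Mapping.single w c)"
      using \<pi>.hom_mult[OF scalar_closed w, symmetric] by (simp add: free_algebra_simps scalar_simps)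
    then show ?case
      using \<pi>.hom_add[OF w comb_closed, of vs c cs] 4 by (simp add: free_algebra_simps)
  qed (simp_all add: zero)
  have scalars: "\<exists>cs. Ks = map (\<lambda>c. ?\<pi> (scalar c)) cs" if "set Ks \<subseteq> ?\<pi> ` range scalar" for Ks
    using that by (intro ex_map_conv[THEN iffD2]) auto
  have "\<pi>.S.independent (?\<pi> ` range scalar) Us"
  proof (rule \<pi>.S.trivial_combine_imp_independent[OF K Us_closed])
    fix Ks assume "set Ks \<subseteq> ?\<pi> ` range scalar" and zero_comb: "\<pi>.S.combine Ks Us = \<zero>\<^bsub>?Q\<^esub>"
    then obtain cs where Ks: "Ks = map (\<lambda>c. ?\<pi> (scalar c)) cs"
      using scalars by blast
    have "linear_comb cs ws - 0 \<in> T_ideal ?U"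
      using zero_comb combine[OF order_refl] \<pi>_eq_iff[OF comb_closed, of ws 0 cs]
      by (simp add: Ks Us_def zero free_algebra_simps)
    then have "linear_comb cs ws = 0"
      using keys_linear_comb[of cs ws] ws by (intro T_ideal_normal_word_eq_0[of _ k]) auto
    then have "cs ! i = 0" if "i < length cs" "i < length ws" for i
      using lookup_linear_comb[OF ws(2) that] by simp
    then show "set (take (length Us) Ks) \<subseteq> {\<zero>\<^bsub>?Q\<^esub>}"
      by (auto simp: Ks Us_def in_set_conv_nth scalar_simps zero)
  qed
  moreover have "\<pi>.S.Span (?\<pi> ` range scalar) Us = rel_free_component d ?U n"
  proof (intro equalityI subsetI)
    fix x assume "x \<in> \<pi>.S.Span (?\<pi> ` range scalar) Us"
    then obtain cs where "x = ?\<pi> (linear_comb cs ws)"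
      using \<pi>.S.Span_mem_iff_length_version[OF K Us_closed] scalars combine[OF order_refl]
      unfolding Us_def by metis
    moreover have "linear_comb cs ws \<in> free_component d n"
      using keys_linear_comb[of cs ws] ws comb_closed[OF order_refl]
      by (auto simp: free_component_def multidegree_eq_iff)
    ultimately show "x \<in> rel_free_component d ?U n"
      by (simp add: rel_free_component_def)
  next
    fix x assume "x \<in> rel_free_component d ?U n"
    then obtain f where f: "x = ?\<pi> f" "f \<in> free_component d n"
      by (auto simp: rel_free_component_def)
    then have deg: "\<And>w. w \<in> Poly_Mapping.keys f \<Longrightarrow> multidegree w = n"
      by (auto simp: free_component_def multidegree_eq_iff)
    have "\<exists>g. Poly_Mapping.keys g \<subseteq> ?N \<and> f - g \<in> T_ideal ?U"
    proof (rule linear_span_mod_T_ideal)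
      fix w assume "w \<in> Poly_Mapping.keys f"
      from word_reduction[of w k] show
        "\<exists>g. Poly_Mapping.keys g \<subseteq> ?N \<and> Poly_Mapping.single w 1 - g \<in> T_ideal ?U"
        unfolding deg[OF \<open>w \<in> Poly_Mapping.keys f\<close>] .
    qed
    then obtain g where g: "Poly_Mapping.keys g \<subseteq> ?N" "f - g \<in> T_ideal ?U"
      by blast
    have "x = ?\<pi> g"
      unfolding f(1) using f(2) g by (subst \<pi>_eq_iff) (auto simp: free_component_def intro!: closed)
    also have "\<dots> = ?\<pi> (linear_comb (map (Poly_Mapping.lookup g) ws) ws)"
      using linear_comb_lookup[OF ws(2), of g] g(1) ws(1) by simp
    also have "\<dots> = \<pi>.S.combine (map (\<lambda>c. ?\<pi> (scalar c)) (map (Poly_Mapping.lookup g) ws)) Us"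
      unfolding Us_def by (rule combine[OF order_refl, symmetric])
    finally show "x \<in> \<pi>.S.Span (?\<pi> ` range scalar) Us"
      by (subst \<pi>.S.Span_mem_iff_length_version[OF K Us_closed], intro exI conjI)
        (auto simp: Us_def)
  qed
  ultimately have "\<pi>.S.dimension (length Us) (?\<pi> ` range scalar) (rel_free_component d ?U n)"
    using \<pi>.S.dimensionI[OF K] by blast
  then have "rel_free_dim d ?U n = length Us"
    using \<pi>.S.dimI[OF K] by (simp add: rel_free_dim_def over_def)
  also have "\<dots> = card ?N"
    using ws by (simp add: Us_def flip: distinct_card)
  finally show ?thesis .
qed

section \<open>Generating functions of sets of words\<close>

definition weight_gf :: "('a \<Rightarrow> nat \<Rightarrow>\<^sub>0 nat) \<Rightarrow> 'a set \<Rightarrow> complex mfps" where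
  "weight_gf wt A = Abs_mfps (\<lambda>n. of_nat (card {a \<in> A. wt a = n}))"

text \<open>
  Without this condition the infinite fibres would be counted as empty in \<open>weight_gf\<close>.
\<close>

definition finite_fibres :: "('a \<Rightarrow> 'b) \<Rightarrow> 'a set \<Rightarrow> bool" where
  "finite_fibres f A \<longleftrightarrow> (\<forall>n. finite {a \<in> A. f a = n})"

lemma weight_gf_Un:
  assumes "finite_fibres wt A" "finite_fibres wt B" "A \<inter> B = {}"
  shows "weight_gf wt (A \<union> B) = weight_gf wt A + weight_gf wt B"
proof (rule mfps_ext)
  fix n
  have "{a \<in> A \<union> B. wt a = n} = {a \<in> A. wt a = n} \<union> {a \<in> B. wt a = n}"
    by auto
  moreover have "card ({a \<in> A. wt a = n} \<union> {a \<in> B. wt a = n}) =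
      card {a \<in> A. wt a = n} + card {a \<in> B. wt a = n}"
    using assms by (intro card_Un_disjoint) (auto simp: finite_fibres_def)
  ultimately show "mfps_nth (weight_gf wt (A \<union> B)) n = mfps_nth (weight_gf wt A + weight_gf wt B) n"
    by (simp add: weight_gf_def plus_mfps.rep_eq)
qed

lemma weight_gf_Times:
  assumes "finite_fibres wt A" "finite_fibres wt' B"
  shows "weight_gf (\<lambda>(a, b). wt a + wt' b) (A \<times> B) = weight_gf wt A * weight_gf wt' B"
proof (rule mfps_ext)
  fix n
  have "{p \<in> A \<times> B. (case p of (a, b) \<Rightarrow> wt a + wt' b) = n} =
      (\<Union>(i, j)\<in>splits n. {a \<in> A. wt a = i} \<times> {b \<in> B. wt' b = j})"
    by (auto simp: splits_def)
  moreover have "card (\<Union>(i, j)\<in>splits n. {a \<in> A. wt a = i} \<times> {b \<in> B. wt' b = j}) =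
      (\<Sum>(i, j)\<in>splits n. card ({a \<in> A. wt a = i} \<times> {b \<in> B. wt' b = j}))"
    unfolding case_prod_unfold
    using assms by (intro card_UN_disjoint) (auto simp: finite_fibres_def)
  ultimately show "mfps_nth (weight_gf (\<lambda>(a, b). wt a + wt' b) (A \<times> B)) n =
      mfps_nth (weight_gf wt A * weight_gf wt' B) n"
    by (simp add: weight_gf_def times_mfps.rep_eq card_cartesian_product case_prod_unfold)
qed

lemma weight_gf_bij:
  assumes "bij_betw f A B" "\<And>a. a \<in> A \<Longrightarrow> wt' (f a) = wt a"
  shows "weight_gf wt A = weight_gf wt' B"
proof -
  have "card {a \<in> A. wt a = n} = card {b \<in> B. wt' b = n}" for n
  proof (rule bij_betw_same_card)
    show "bij_betw f {a \<in> A. wt a = n} {b \<in> B. wt' b = n}"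
      using assms by (auto simp: bij_betw_def inj_on_def image_iff)
  qed
  then show ?thesis
    by (simp add: weight_gf_def)
qed

abbreviation word_gf :: "nat list set \<Rightarrow> complex mfps" where
  "word_gf \<equiv> weight_gf multidegree"

lemma finite_fibres_words [simp]: "finite_fibres multidegree A"
  unfolding finite_fibres_def
  by (auto intro: finite_subset[OF _ finite_words_of_multidegree])

lemma word_gf_concat:
  assumes "bij_betw (\<lambda>(u, v). u @ v) (A \<times> B) C"
  shows "word_gf A * word_gf B = word_gf C"
proof -
  have "word_gf A * word_gf B = weight_gf (\<lambda>(u, v). multidegree u + multidegree v) (A \<times> B)"
    by (rule weight_gf_Times[symmetric]) simp_all
  also have "\<dots> = word_gf C"
    by (rule weight_gf_bij[OF assms]) auto
  finally show ?thesis .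
qed

lemma word_gf_Nil: "word_gf {[]} = 1"
proof (rule mfps_ext)
  fix n :: "nat \<Rightarrow>\<^sub>0 nat"
  have "{w \<in> {[]}. multidegree w = n} = (if n = 0 then {[]} else {})"
    by auto
  then show "mfps_nth (word_gf {[]}) n = mfps_nth 1 n"
    by (simp add: weight_gf_def one_mfps.rep_eq)
qed

lemma word_gf_letter: "word_gf {[i]} = mfps_X i"
proof (rule mfps_ext)
  fix n :: "nat \<Rightarrow>\<^sub>0 nat"
  have "{w \<in> {[i]}. multidegree w = n} = (if n = Poly_Mapping.single i 1 then {[i]} else {})"
    by auto
  then show "mfps_nth (word_gf {[i]}) n = mfps_nth (mfps_X i) n"
    by (simp add: weight_gf_def mfps_X_def)
qed

lemma word_gf_letters: "word_gf {[i] |i. i < d} = (\<Sum>i<d. mfps_X i)"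
proof (induction d)
  case 0
  show ?case
    by (rule mfps_ext) (simp add: weight_gf_def zero_mfps.rep_eq)
next
  case (Suc d)
  have "{[i] |i. i < Suc d} = {[i] |i. i < d} \<union> {[d]}"
    by (auto simp: less_Suc_eq)
  moreover have "word_gf ({[i] |i. i < d} \<union> {[d]}) = word_gf {[i] |i. i < d} + word_gf {[d]}"
    by (rule weight_gf_Un) auto
  ultimately show ?case
    using Suc by (simp only: word_gf_letter sum.lessThan_Suc)
qed

definition sorted_words :: "nat \<Rightarrow> nat list set" where
  "sorted_words d = {w. sorted w \<and> set w \<subseteq> {..<d}}"

lemma sorted_words_Suc: "sorted_words (Suc d) = sorted_words d \<union> (\<lambda>w. w @ [d]) ` sorted_words (Suc d)"
proof (intro equalityI subsetI)
  fix w assume w: "w \<in> sorted_words (Suc d)"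
  show "w \<in> sorted_words d \<union> (\<lambda>w. w @ [d]) ` sorted_words (Suc d)"
  proof (cases "d \<in> set w")
    case False
    with w show ?thesis
      by (auto simp: sorted_words_def less_Suc_eq)
  next
    case True
    then obtain u x where u: "w = u @ [x]"
      by (cases w rule: rev_cases) auto
    with w True have "x = d"
      by (force simp: sorted_words_def sorted_append)
    with w u show ?thesis
      by (auto simp: sorted_words_def sorted_append)
  qed
next
  fix w assume "w \<in> sorted_words d \<union> (\<lambda>w. w @ [d]) ` sorted_words (Suc d)"
  then show "w \<in> sorted_words (Suc d)"
    by (auto simp: sorted_words_def sorted_append less_Suc_eq_le subset_iff less_imp_le)
qed

text \<open>
  A sorted word over \<open>{..d}\<close> either avoids the largest letter \<open>d\<close> or ends with it, so the series \<open>S\<close> for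
  \<open>d + 1\<close> letters and the series \<open>S'\<close> for \<open>d\<close> letters satisfy \<open>S = S' + S t\<^sub>d\<close>.
\<close>

lemma word_gf_sorted_words: "word_gf (sorted_words d) = (\<Prod>i<d. 1 / (1 - mfps_X i))"
proof (induction d)
  case 0
  have "sorted_words 0 = {[]}"
    by (auto simp: sorted_words_def)
  then show ?case
    by (simp add: word_gf_Nil)
next
  case (Suc d)
  have "bij_betw (\<lambda>(u, v). u @ v) (sorted_words (Suc d) \<times> {[d]})
      ((\<lambda>w. w @ [d]) ` sorted_words (Suc d))"
    by (auto simp: bij_betw_def inj_on_def image_def)
  from word_gf_concat[OF this]
  have "word_gf ((\<lambda>w. w @ [d]) ` sorted_words (Suc d)) = word_gf (sorted_words (Suc d)) * mfps_X d"
    by (simp only: word_gf_letter)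
  moreover have "sorted_words d \<inter> (\<lambda>w. w @ [d]) ` sorted_words (Suc d) = {}"
    by (auto simp: sorted_words_def)
  ultimately have "word_gf (sorted_words (Suc d)) =
      word_gf (sorted_words d) + word_gf (sorted_words (Suc d)) * mfps_X d"
    by (subst (1) sorted_words_Suc) (simp add: weight_gf_Un)
  then have "word_gf (sorted_words (Suc d)) * (1 - mfps_X d) = word_gf (sorted_words d)"
    by (simp add: algebra_simps)
  moreover have "(1 - mfps_X d) * inverse (1 - mfps_X d) = (1 :: complex mfps)"
    by (rule mfps_right_inverse)
      (auto simp: minus_mfps.rep_eq one_mfps.rep_eq mfps_X_def poly_mapping_eq_iff fun_eq_iff
        lookup_single when_def split: if_splits)
  ultimately have "word_gf (sorted_words (Suc d)) = word_gf (sorted_words d) * inverse (1 - mfps_X d)"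
    by (metis mult.assoc mult.right_neutral)
  with Suc show ?case
    by (simp add: divide_mfps_def)
qed

section \<open>Counting normal words\<close>

definition normal_words :: "nat \<Rightarrow> nat \<Rightarrow> nat list set" where
  "normal_words d k = {w. set w \<subseteq> {..<d} \<and> greedy_descents w < k}"

lemma greedy_descents_eq_0_iff: "greedy_descents w = 0 \<longleftrightarrow> sorted w"
  by (induction w rule: greedy_descents.induct) auto

lemma greedy_descents_append:
  assumes "sorted m" "m \<noteq> []" "i < last m"
  shows "greedy_descents (m @ i # v) = Suc (greedy_descents v)"
  using assms
proof (induction m)
  case (Cons a m)
  then show ?case
    by (cases m) auto
qed simp

definition descent_words :: "nat \<Rightarrow> nat list set" where
  "descent_words d = {m @ [i] |m i. m \<in> sorted_words d \<and> m \<noteq> [] \<and> i < last m}"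

lemma greedy_descents_first_descent:
  assumes "greedy_descents w \<noteq> 0"
  shows "\<exists>m i v. w = m @ i # v \<and> sorted m \<and> m \<noteq> [] \<and> i < last m"
  using assms
proof (induction w rule: greedy_descents.induct)
  case (1 x y w)
  show ?case
  proof (cases "y < x")
    case True
    then show ?thesis
      by (intro exI[of _ "[x]"] exI[of _ y] exI[of _ w]) simp
  next
    case False
    then obtain m i v where m: "y # w = m @ i # v" "sorted m" "m \<noteq> []" "i < last m"
      using 1 by auto
    then have "sorted (x # m)"
      using False by (cases m) auto
    with m show ?thesis
      by (intro exI[of _ "x # m"] exI[of _ i] exI[of _ v]) simp
  qed
qed simp_all

text \<open>
  The prefix in \<open>descent_words\<close> ends behind the first descent of the whole word, so the word
  determines it.
\<close>

lemma inj_descent_words_append: "inj_on (\<lambda>(u, v). u @ v) (descent_words d \<times> B)"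
proof -
  have aux: "m = m'" if "m @ i # v = m' @ i' # v'" "sorted m" "m \<noteq> []" "i < last m"
      "sorted m'" "m' \<noteq> []" "i' < last m'" for m m' :: "nat list" and i i' v v'
    using that
  proof (induction m arbitrary: m')
    case (Cons a m)
    then obtain m'' where m': "m' = a # m''"
      by (cases m') auto
    show ?case
    proof (cases "m = [] \<or> m'' = []")
      case True
      then show ?thesis
        using Cons.prems m' by (cases m; cases m''; force)
    next
      case False
      then show ?thesis
        using Cons.IH[of m''] Cons.prems m' by auto
    qed
  qed simp
  show ?thesis
  proof (rule inj_onI, clarify)
    fix u v u' v'
    assume "u \<in> descent_words d" "u' \<in> descent_words d" and eq: "u @ v = u' @ v'"
    then obtain m i m' i' where u: "u = m @ [i]" "u' = m' @ [i']" and
      "sorted m" "m \<noteq> []" "i < last m" "sorted m'" "m' \<noteq> []" "i' < last m'"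
      by (auto simp: descent_words_def sorted_words_def)
    moreover from this eq have "m = m'"
      by (intro aux[of m i v m' i' v']) simp_all
    ultimately show "u = u' \<and> v = v'"
      using eq by simp
  qed
qed

text \<open>
  A normal word without descents is sorted; any other one is cut behind its first descent, which is
  always a greedy one, and the remaining word has one greedy descent less.
\<close>

lemma word_gf_normal_words_Suc:
  "word_gf (normal_words d (Suc k)) =
     word_gf (sorted_words d) + word_gf (descent_words d) * word_gf (normal_words d k)"
proof -
  have "(\<lambda>(u, v). u @ v) ` (descent_words d \<times> normal_words d k) =
      {w \<in> normal_words d (Suc k). greedy_descents w \<noteq> 0}"
  proof (intro equalityI subsetI)
    fix w assume "w \<in> (\<lambda>(u, v). u @ v) ` (descent_words d \<times> normal_words d k)"
    then obtain m i v where "w = m @ i # v" "m \<in> sorted_words d" "m \<noteq> []" "i < last m"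
      "v \<in> normal_words d k"
      by (auto simp: descent_words_def)
    moreover from this have "last m \<in> {..<d}"
      using last_in_set[of m] unfolding sorted_words_def by blast
    ultimately show "w \<in> {w \<in> normal_words d (Suc k). greedy_descents w \<noteq> 0}"
      by (auto simp: normal_words_def sorted_words_def greedy_descents_append)
  next
    fix w assume w: "w \<in> {w \<in> normal_words d (Suc k). greedy_descents w \<noteq> 0}"
    then obtain m i v where m: "w = m @ i # v" "sorted m" "m \<noteq> []" "i < last m"
      using greedy_descents_first_descent by blast
    then have "m @ [i] \<in> descent_words d" "v \<in> normal_words d k"
      using w by (auto simp: descent_words_def normal_words_def sorted_words_def greedy_descents_append)
    then show "w \<in> (\<lambda>(u, v). u @ v) ` (descent_words d \<times> normal_words d k)"
      by (intro image_eqI[of _ _ "(m @ [i], v)"]) (simp_all add: m(1))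
  qed
  then have "word_gf (descent_words d) * word_gf (normal_words d k) =
      word_gf {w \<in> normal_words d (Suc k). greedy_descents w \<noteq> 0}"
    by (intro word_gf_concat) (simp add: bij_betw_def inj_descent_words_append)
  moreover have "normal_words d (Suc k) =
      sorted_words d \<union> {w \<in> normal_words d (Suc k). greedy_descents w \<noteq> 0}"
    by (auto simp: normal_words_def sorted_words_def greedy_descents_eq_0_iff)
      (metis greedy_descents_eq_0_iff zero_less_Suc)
  moreover have "sorted_words d \<inter> {w \<in> normal_words d (Suc k). greedy_descents w \<noteq> 0} = {}"
    by (auto simp: sorted_words_def greedy_descents_eq_0_iff)
  then have "word_gf (sorted_words d \<union> {w \<in> normal_words d (Suc k). greedy_descents w \<noteq> 0}) =
      word_gf (sorted_words d) + word_gf {w \<in> normal_words d (Suc k). greedy_descents w \<noteq> 0}"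
    by (intro weight_gf_Un) simp_all
  ultimately show ?thesis
    by presburger
qed

text \<open>
  Appending a letter \<open>i\<close> to a sorted word \<open>m\<close> gives a word in \<open>descent_words\<close> if \<open>m \<noteq> []\<close> and
  \<open>i < last m\<close>, and every nonempty sorted word exactly once otherwise.
\<close>

lemma word_gf_descent_words:
  "word_gf (descent_words d) = 1 + ((\<Sum>i<d. mfps_X i) - 1) * word_gf (sorted_words d)"
proof -
  have "bij_betw (\<lambda>(u, v). u @ v) (sorted_words d \<times> {[i] |i. i < d})
      (descent_words d \<union> (sorted_words d - {[]}))"
    unfolding bij_betw_def
  proof
    show "inj_on (\<lambda>(u, v). u @ v) (sorted_words d \<times> {[i] |i. i < d})"
      by (auto simp: inj_on_def)
    show "(\<lambda>(u, v). u @ v) ` (sorted_words d \<times> {[i] |i. i < d}) =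
        descent_words d \<union> (sorted_words d - {[]})"
    proof (intro equalityI subsetI)
      fix w assume "w \<in> (\<lambda>(u, v). u @ v) ` (sorted_words d \<times> {[i] |i. i < d})"
      then obtain m i where m: "w = m @ [i]" "m \<in> sorted_words d" "i < d"
        by auto
      show "w \<in> descent_words d \<union> (sorted_words d - {[]})"
      proof (cases "m \<noteq> [] \<and> i < last m")
        case True
        with m show ?thesis
          by (auto simp: descent_words_def)
      next
        case False
        have "x \<le> i" if "x \<in> set m" for x
        proof -
          have "x \<le> last m"
            using m(2) that by (cases m rule: rev_cases) (auto simp: sorted_words_def sorted_append)
          with False that show ?thesis by force
        qed
        with m show ?thesis
          by (simp add: sorted_words_def sorted_append)
      qed
    next
      fix w assume "w \<in> descent_words d \<union> (sorted_words d - {[]})"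
      then consider (descent) m i where "w = m @ [i]" "m \<in> sorted_words d" "m \<noteq> []" "i < last m"
        | (sorted) "w \<in> sorted_words d" "w \<noteq> []"
        by (auto simp: descent_words_def)
      then obtain m i where "w = m @ [i]" "m \<in> sorted_words d" "i < d"
      proof cases
        case (descent m i)
        then have "last m \<in> {..<d}"
          using last_in_set[of m] unfolding sorted_words_def by blast
        with descent show thesis
          by (intro that[of m i]) simp_all
      next
        case sorted
        then show thesis
          by (cases w rule: rev_cases) (auto simp: sorted_words_def sorted_append intro: that)
      qed
      then show "w \<in> (\<lambda>(u, v). u @ v) ` (sorted_words d \<times> {[i] |i. i < d})"
        by (intro image_eqI[of _ _ "(m, [i])"]) auto
    qed
  qed
  from word_gf_concat[OF this] have "word_gf (sorted_words d) * (\<Sum>i<d. mfps_X i) =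
      word_gf (descent_words d \<union> (sorted_words d - {[]}))"
    by (simp only: word_gf_letters)
  also have "descent_words d \<inter> (sorted_words d - {[]}) = {}"
  proof -
    have "\<not> sorted (m @ [i])" if "m \<noteq> []" "i < last m" for m :: "nat list" and i
      using that by (auto simp: sorted_append not_le intro!: bexI[of _ "last m"])
    then show ?thesis
      by (auto simp: descent_words_def sorted_words_def)
  qed
  then have "word_gf (descent_words d \<union> (sorted_words d - {[]})) =
      word_gf (descent_words d) + word_gf (sorted_words d - {[]})"
    by (simp add: weight_gf_Un)
  also have "word_gf (sorted_words d) = word_gf ({[]} \<union> (sorted_words d - {[]}))"
    by (rule arg_cong[where f = word_gf]) (auto simp: sorted_words_def)
  then have "word_gf (sorted_words d - {[]}) = word_gf (sorted_words d) - 1"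
    by (subst (asm) weight_gf_Un) (simp_all add: word_gf_Nil)
  finally show ?thesis
    by (simp add: algebra_simps)
qed

text \<open>
  Multiplying the recursion by \<open>e = (\<Sum>i<d. mfps_X i) - 1\<close> makes \<open>1 + e W\<^sub>k\<close> a geometric sequence with
  ratio \<open>1 + e P\<close>, where \<open>W\<^sub>k\<close> and \<open>P\<close> are the series of the normal and of the sorted words.
\<close>

lemma word_gf_normal_words:
  "((\<Sum>i<d. mfps_X i) - 1) * word_gf (normal_words d k) =
     (1 + ((\<Sum>i<d. mfps_X i) - 1) * (\<Prod>i<d. 1 / (1 - mfps_X i))) ^ k - 1"
proof (induction k)
  case 0
  have "word_gf (normal_words d 0) = 0"
    by (rule mfps_ext) (simp add: weight_gf_def normal_words_def zero_mfps.rep_eq)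
  then show ?case by simp
next
  case (Suc k)
  let ?e = "(\<Sum>i<d. mfps_X i) - 1 :: complex mfps"
  let ?P = "(\<Prod>i<d. 1 / (1 - mfps_X i)) :: complex mfps"
  have "?e * word_gf (normal_words d (Suc k)) =
      ?e * ?P + (1 + ?e * ?P) * (?e * word_gf (normal_words d k))"
    by (simp add: word_gf_normal_words_Suc word_gf_descent_words word_gf_sorted_words algebra_simps)
  also have "\<dots> = (1 + ?e * ?P) ^ Suc k - 1"
    unfolding Suc by (simp add: algebra_simps)
  finally show ?case .
qed

lemma one_plus_power_minus_one:
  fixes e p :: "'a::comm_ring_1"
  shows "(1 + e * p) ^ k - 1 = e * (\<Sum>j = 1..k. of_nat (k choose j) * p ^ j * e ^ (j - 1))"
proof -
  have "(1 + e * p) ^ k = (\<Sum>j\<le>k. of_nat (k choose j) * (e * p) ^ j)"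
    using binomial_ring[of "e * p" 1 k] by (simp add: add.commute)
  also have "{..k} = insert 0 {1..k}"
    by auto
  finally have "(1 + e * p) ^ k - 1 = (\<Sum>j = 1..k. of_nat (k choose j) * (e * p) ^ j)"
    by simp
  also have "\<dots> = (\<Sum>j = 1..k. e * (of_nat (k choose j) * p ^ j * e ^ (j - 1)))"
  proof (rule sum.cong)
    fix j assume "j \<in> {1..k}"
    then have "e ^ j = e * e ^ (j - 1)"
      by (cases j) auto
    then show "of_nat (k choose j) * (e * p) ^ j = e * (of_nat (k choose j) * p ^ j * e ^ (j - 1))"
      by (simp add: power_mult_distrib mult_ac)
  qed simp
  finally show ?thesis
    by (simp add: sum_distrib_left)
qed

section \<open>The Hilbert series\<close>

lemma mfps_nth_sum: "mfps_nth (sum f S) n = (\<Sum>i\<in>S. mfps_nth (f i) n)"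
  by (induction S rule: infinite_finite_induct) (simp_all add: zero_mfps.rep_eq plus_mfps.rep_eq)

lemma mfps_nth_X_0: "mfps_nth (mfps_X i) 0 = 0"
  by (auto simp: mfps_X_def poly_mapping_eq_iff fun_eq_iff lookup_single when_def)

lemma hilbert_series_upper_triangular:
  assumes "k \<ge> 1"
  shows "hilbert_series d (upper_triangular_algebra k :: ('k::field_char_0, 'k mat) module) =
    word_gf (normal_words d k)"
proof (rule mfps_ext)
  fix n :: "nat \<Rightarrow>\<^sub>0 nat"
  have "{w \<in> normal_words d k. multidegree w = n} =
      (if Poly_Mapping.keys n \<subseteq> {..<d} then {w. multidegree w = n \<and> greedy_descents w < k} else {})"
    by (auto simp: normal_words_def keys_multidegree)
  then show "mfps_nth (hilbert_series d (upper_triangular_algebra k :: ('k, 'k mat) module)) n =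
      mfps_nth (word_gf (normal_words d k)) n"
    using rel_free_dim_upper_triangular[OF assms, of n d, where 'k = 'k]
    by (simp add: hilbert_series_def weight_gf_def)
qed

theorem theorem12:
  fixes k d :: nat
  assumes "k \<ge> 1" and "d \<ge> 1"
  shows
    "hilbert_series d (upper_triangular_algebra k :: ('k::field_char_0, 'k mat) module) =
       1 / ((\<Sum>i<d. mfps_X i) - 1) *
         ((1 + ((\<Sum>i<d. mfps_X i) - 1) * (\<Prod>i<d. 1 / (1 - mfps_X i))) ^ k - 1) \<and>
     hilbert_series d (upper_triangular_algebra k :: ('k, 'k mat) module) =
       (\<Sum>j = 1..k. of_nat (k choose j) * (\<Prod>i<d. 1 / (1 - mfps_X i)) ^ j *
         ((\<Sum>i<d. mfps_X i) - 1) ^ (j - 1))"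
proof -
  let ?e = "(\<Sum>i<d. mfps_X i) - 1 :: complex mfps"
  let ?P = "(\<Prod>i<d. 1 / (1 - mfps_X i)) :: complex mfps"
  let ?W = "word_gf (normal_words d k)"
  let ?S = "\<Sum>j = 1..k. of_nat (k choose j) * ?P ^ j * ?e ^ (j - 1)"
  have "mfps_nth ?e 0 \<noteq> 0"
    by (simp add: minus_mfps.rep_eq mfps_nth_sum mfps_nth_X_0 one_mfps.rep_eq)
  then have "?e * inverse ?e = 1"
    by (rule mfps_right_inverse)
  moreover have "1 / ?e * (?e * F) = ?e * inverse ?e * F" for F
    by (simp only: divide_mfps_def mult_1 mult_ac)
  ultimately have cancel: "1 / ?e * (?e * F) = F" for F
    by simp
  have "?W = 1 / ?e * ((1 + ?e * ?P) ^ k - 1)"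
    using cancel[of ?W] by (simp only: word_gf_normal_words)
  moreover have "\<dots> = ?S"
    unfolding one_plus_power_minus_one by (rule cancel)
  ultimately show ?thesis
    by (simp only: hilbert_series_upper_triangular[OF assms(1)])
qed

end
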